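(* Let $m\ge2$. For every prime power $q$, the proportion of $[m\times2;2]_q$-MRD codes within the space of all $m$-dimensional rank-metric codes in $\mathbb{F}_q^{m\times2}$, that is, the number of $m$-dimensional $\mathbb{F}_q$-subspaces of $\mathbb{F}_q^{m\times 2}$ all of whose nonzero elements have rank $2$ divided by the number of all $m$-dimensional $\mathbb{F}_q$-subspaces of $\mathbb{F}_q^{m\times2}$, is given by $$\frac{s_m(q)}{q^{m^2}}\cdot\frac{\prod_{i=0}^{m-1}(q^{2m}-q^{i+m})}{\prod_{i=0}^{m-1}(q^{2m}-q^i)},$$ and it converges to $\sum_{j=0}^m\frac{(-1)^j}{j!}$ as $q\rightarrow\infty$.
   Context: $s_m(q)=|\{A\in\mathbb{F}_q^{m\times m}\mid \sigma(A)=\emptyset\}|$, where $\sigma(A)=\{\lambda\in\mathbb{F}_q\mid\lambda\text{ is an eigenvalue of }A\}$ is the set of eigenvalues of $A$ lying in $\mathbb{F}_q$. A rank-metric code is an $\mathbb{F}_q$-linear subspace of a matrix space; an $[m\times 2;2]_q$-MRD code is an $m$-dimensional subspace of $\mathbb{F}_q^{m\times2}$ with all nonzero elements of rank $2$. The limit $q\to\infty$ is over prime powers. *)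

theory Defs
  imports
    Complex_Main
    "HOL-Number_Theory.Prime_Powers"
    "Jordan_Normal_Form.Missing_VectorSpace"
    "Jordan_Normal_Form.Matrix"
begin

text \<open>
  The order of the field has to vary inside a single statement, so finite fields are
  HOL-Algebra records \<^typ>\<open>'a ring\<close> rather than instances of the type class \<^class>\<open>field\<close>.
  The types \<^typ>\<open>'a vec\<close> and \<^typ>\<open>'a mat\<close> serve as containers whose
  entries are restricted to \<^term>\<open>carrier F\<close>; the arithmetic is the one of the record.
  The fields \<^const>\<open>mult\<close> and \<^const>\<open>one\<close> of a module record play no role for vector spaces.
\<close>

definition coord_space :: "'a ring \<Rightarrow> nat \<Rightarrow> ('a, 'a vec) module" where
  "coord_space F n = \<lparr>
     carrier = {v \<in> carrier_vec n. \<forall>i<n. v $ i \<in> carrier F},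
     mult = undefined, one = undefined,
     zero = vec n (\<lambda>_. \<zero>\<^bsub>F\<^esub>),
     add = (\<lambda>v w. vec n (\<lambda>i. v $ i \<oplus>\<^bsub>F\<^esub> w $ i)),
     smult = (\<lambda>a v. vec n (\<lambda>i. a \<otimes>\<^bsub>F\<^esub> v $ i))\<rparr>"

definition matrix_space :: "'a ring \<Rightarrow> nat \<Rightarrow> nat \<Rightarrow> ('a, 'a mat) module" where
  "matrix_space F m n = \<lparr>
     carrier = {A \<in> carrier_mat m n. \<forall>i<m. \<forall>j<n. A $$ (i, j) \<in> carrier F},
     mult = undefined, one = undefined,
     zero = mat m n (\<lambda>_. \<zero>\<^bsub>F\<^esub>),
     add = (\<lambda>A B. mat m n (\<lambda>ij. A $$ ij \<oplus>\<^bsub>F\<^esub> B $$ ij)),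
     smult = (\<lambda>a A. mat m n (\<lambda>ij. a \<otimes>\<^bsub>F\<^esub> A $$ ij))\<rparr>"

definition mat_vec_prod :: "'a ring \<Rightarrow> 'a mat \<Rightarrow> 'a vec \<Rightarrow> 'a vec" where
  "mat_vec_prod F A v =
     vec (dim_row A) (\<lambda>i. \<Oplus>\<^bsub>F\<^esub> j \<in> {..<dim_col A}. A $$ (i, j) \<otimes>\<^bsub>F\<^esub> v $ j)"

definition mat_rank :: "'a ring \<Rightarrow> 'a mat \<Rightarrow> nat" where
  "mat_rank F A =
     (let V = coord_space F (dim_row A)
      in vectorspace.dim F (V\<lparr>carrier := module.span F V (set (cols A))\<rparr>))"

definition eigenvalues :: "'a ring \<Rightarrow> 'a mat \<Rightarrow> 'a set" where
  "eigenvalues F A =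
     (let V = coord_space F (dim_row A)
      in {l \<in> carrier F. \<exists>v \<in> carrier V. v \<noteq> \<zero>\<^bsub>V\<^esub> \<and> mat_vec_prod F A v = l \<odot>\<^bsub>V\<^esub> v})"

definition spectrum_free_count :: "'a ring \<Rightarrow> nat \<Rightarrow> nat" where
  "spectrum_free_count F m = card {A \<in> carrier (matrix_space F m m). eigenvalues F A = {}}"

definition rank_metric_codes :: "'a ring \<Rightarrow> nat \<Rightarrow> nat \<Rightarrow> nat \<Rightarrow> 'a mat set set" where
  "rank_metric_codes F m n k =
     {C. VectorSpace.subspace F C (matrix_space F m n) \<and>
         vectorspace.dim F ((matrix_space F m n)\<lparr>carrier := C\<rparr>) = k}"

definition mrd_codes :: "'a ring \<Rightarrow> nat \<Rightarrow> 'a mat set set" where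
  "mrd_codes F m =
     {C \<in> rank_metric_codes F m 2 m.
        \<forall>A \<in> C. A \<noteq> \<zero>\<^bsub>matrix_space F m 2\<^esub> \<longrightarrow> mat_rank F A = 2}"

definition mrd_proportion :: "'a ring \<Rightarrow> nat \<Rightarrow> real" where
  "mrd_proportion F m = real (card (mrd_codes F m)) / real (card (rank_metric_codes F m 2 m))"

lemma vectorspace_coord_space:
  assumes "field F"
  shows "vectorspace F (coord_space F n)"
proof -
  interpret field F by fact
  have neg: "\<exists>B. B \<in> carrier_vec n \<and> (\<forall>i<n. B $ i \<in> carrier F) \<and>
          vec n (\<lambda>i. B $ i \<oplus>\<^bsub>F\<^esub> A $ i) = vec n (\<lambda>_. \<zero>\<^bsub>F\<^esub>)"
    if "A \<in> carrier_vec n" "(\<forall>i<n. A $ i \<in> carrier F)" for A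
    using that by (intro exI[of _ "vec n (\<lambda>i. \<ominus>\<^bsub>F\<^esub> (A $ i))"]) (auto simp: l_neg)
  have "abelian_group (coord_space F n)"
    by (rule abelian_groupI) (auto simp: coord_space_def a_ac neg)
  then have "module F (coord_space F n)"
    by (intro module.intro module_axioms.intro is_cring)
       (auto simp: coord_space_def l_distr r_distr m_assoc)
  then show ?thesis
    by (intro vectorspace.intro field_axioms)
qed

lemma vectorspace_matrix_space:
  assumes "field F"
  shows "vectorspace F (matrix_space F m n)"
proof -
  interpret field F by fact
  have neg: "\<exists>B. B \<in> carrier_mat m n \<and> (\<forall>i<m. \<forall>j<n. B $$ (i, j) \<in> carrier F) \<and>
          mat m n (\<lambda>i. B $$ i \<oplus>\<^bsub>F\<^esub> A $$ i) = mat m n (\<lambda>_. \<zero>\<^bsub>F\<^esub>)"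
    if "A \<in> carrier_mat m n" "(\<forall>i<m. \<forall>j<n. A $$ (i, j) \<in> carrier F)" for A
    using that by (intro exI[of _ "mat m n (\<lambda>i. \<ominus>\<^bsub>F\<^esub> (A $$ i))"]) (auto simp: l_neg)
  have "abelian_group (matrix_space F m n)"
    by (rule abelian_groupI) (auto simp: matrix_space_def a_ac neg)
  then have "module F (matrix_space F m n)"
    by (intro module.intro module_axioms.intro is_cring)
       (auto simp: matrix_space_def l_distr r_distr m_assoc)
  then show ?thesis
    by (intro vectorspace.intro field_axioms)
qed

end

theory Submission
  imports Defs "HOL-Real_Asymp.Real_Asymp"
begin

text \<open>
  An MRD code projects bijectively onto its first column, so it is the graph of a unique
  $m \times m$ matrix $B$, and the rank condition says exactly that $B$ has no eigenvalue. The formula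
  is therefore $s_m(q)$ divided by the Gaussian binomial coefficient counting $m$-dimensional subspaces.

  For the limit, inclusion-exclusion over sets of eigenvalues writes $s_m(q) / q^{m^2}$ as
  $\sum_{j \le m} (-1)^j S_j$, where $S_j$ sums, over the $j$-sets $L$ of scalars, the probability
  that all elements of $L$ are eigenvalues. Eigenvectors for distinct eigenvalues are independent, and
  prescribing the values of a matrix on $j$ independent vectors has probability $q^{-mj}$. Counting pairs
  of a matrix and a tuple of eigenvectors thus gives probability $(q-1)^{-j} (1 + O(1/q))$ for each $L$,
  whence $S_j \to 1/j!$.
\<close>

section \<open>Independent lists of vectors\<close>

text \<open>Counting matrices directly by their eigenvalues is awkward, because eigenspaces of
  dimension above one make the number of eigenvectors irregular. Pairs of an operator and an
  independent eigenvector tuple can be counted exactly: the tuple fixes the operator on a subspace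
  and leaves it free on a complement. The irregular eigenspaces then enter only as an error of
  relative size O(1/q). There are \<open>q choose j\<close> sets of j scalars, about q^j / j!, which
  cancels the probability (q-1)^(-j); this is the origin of 1/j!. Since an operator on an
  m-dimensional space has at most m eigenvalues, the alternating sum has m + 1 terms whatever q is,
  so the limit can be taken term by term. Dimension is handled as cardinality: a subspace of
  dimension d is one with q^d elements. Extension to a basis and surjectivity thereby become
  comparisons of finite cardinalities.\<close>

context vectorspace
begin

lemma span_singleton:
  assumes "v \<in> carrier V"
  shows "span {v} = (\<lambda>a. a \<odot>\<^bsub>V\<^esub> v) ` carrier K"
proof -
  have *: "lincomb a {v} = a v \<odot>\<^bsub>V\<^esub> v" if "a \<in> {v} \<rightarrow> carrier K" for a
    using that assms by (auto simp: lincomb_def)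
  have "span {v} = {lincomb a {v} | a. a \<in> {v} \<rightarrow> carrier K}"
    using assms by (intro finite_span) auto
  also have "\<dots> = (\<lambda>a. a \<odot>\<^bsub>V\<^esub> v) ` carrier K"
  proof (intro equalityI subsetI)
    fix w assume "w \<in> (\<lambda>a. a \<odot>\<^bsub>V\<^esub> v) ` carrier K"
    then obtain a where "a \<in> carrier K" "w = a \<odot>\<^bsub>V\<^esub> v" by blast
    with *[of "\<lambda>_. a"] show "w \<in> {lincomb a {v} | a. a \<in> {v} \<rightarrow> carrier K}"
      by force
  qed (use * in auto)
  finally show ?thesis .
qed

lemma span_insert:
  assumes "v \<in> carrier V" "S \<subseteq> carrier V"
  shows "span (insert v S) =
    (\<lambda>(a, u). a \<odot>\<^bsub>V\<^esub> v \<oplus>\<^bsub>V\<^esub> u) ` (carrier K \<times> span S)"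
  using span_union_is_sum[of "{v}" S] assms
  by (force simp: submodule_sum_def span_singleton image_iff)

lemma submodule_diff_closed:
  assumes "submodule K W V" "u \<in> W" "w \<in> W"
  shows "u \<ominus>\<^bsub>V\<^esub> w \<in> W"
proof -
  interpret submodule K W V by fact
  have "u \<in> carrier V" "w \<in> carrier V"
    using assms subset by auto
  then have "u \<ominus>\<^bsub>V\<^esub> w = u \<oplus>\<^bsub>V\<^esub> (\<ominus>\<^bsub>K\<^esub> \<one>\<^bsub>K\<^esub>) \<odot>\<^bsub>V\<^esub> w"
    by (simp add: a_minus_def smult_minus_1)
  with assms show ?thesis by auto
qed

lemma smult_mem_submodule_iff:
  assumes "submodule K W V" "a \<in> carrier K" "v \<in> carrier V" "a \<noteq> \<zero>\<^bsub>K\<^esub>"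
  shows "a \<odot>\<^bsub>V\<^esub> v \<in> W \<longleftrightarrow> v \<in> W"
proof
  assume "a \<odot>\<^bsub>V\<^esub> v \<in> W"
  moreover have "v = inv\<^bsub>K\<^esub> a \<odot>\<^bsub>V\<^esub> (a \<odot>\<^bsub>V\<^esub> v)"
    using assms by (intro mult_inverse) auto
  moreover have "inv\<^bsub>K\<^esub> a \<in> carrier K"
    using assms field_Units by auto
  ultimately show "v \<in> W"
    using assms(1) by (metis submodule.smult_closed)
next
  assume "v \<in> W"
  then show "a \<odot>\<^bsub>V\<^esub> v \<in> W"
    using assms by (metis submodule.smult_closed)
qed

text \<open>Subtracting the two expansions puts \<open>(a - b) v = w - u\<close> into
  \<open>W\<close>, while a nonzero multiple of a vector outside \<open>W\<close> stays
  outside.\<close>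

lemma coeff_unique_mod_submodule:
  assumes W: "submodule K W V" and ab: "a \<in> carrier K" "b \<in> carrier K" and v: "v \<in> carrier V"
    and uw: "u \<in> W" "w \<in> W"
    and eq: "a \<odot>\<^bsub>V\<^esub> v \<oplus>\<^bsub>V\<^esub> u = b \<odot>\<^bsub>V\<^esub> v \<oplus>\<^bsub>V\<^esub> w"
    and "v \<notin> W"
  shows "a = b \<and> u = w"
proof -
  have c: "u \<in> carrier V" "w \<in> carrier V"
    using W uw submodule.subset by blast+
  have "(a \<ominus>\<^bsub>K\<^esub> b) \<odot>\<^bsub>V\<^esub> v = w \<ominus>\<^bsub>V\<^esub> u"
  proof -
    have "(a \<ominus>\<^bsub>K\<^esub> b) \<odot>\<^bsub>V\<^esub> v = a \<odot>\<^bsub>V\<^esub> v \<oplus>\<^bsub>V\<^esub> \<ominus>\<^bsub>V\<^esub> (b \<odot>\<^bsub>V\<^esub> v)"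
      using ab v by (simp add: a_minus_def smult_l_distr smult_l_minus)
    also have "\<dots> = (a \<odot>\<^bsub>V\<^esub> v \<oplus>\<^bsub>V\<^esub> u) \<oplus>\<^bsub>V\<^esub> (\<ominus>\<^bsub>V\<^esub> u \<oplus>\<^bsub>V\<^esub> \<ominus>\<^bsub>V\<^esub> (b \<odot>\<^bsub>V\<^esub> v))"
      using ab v c by (simp add: M.a_ac M.r_neg M.r_neg1 M.r_neg2)
    also have "\<dots> = (b \<odot>\<^bsub>V\<^esub> v \<oplus>\<^bsub>V\<^esub> w) \<oplus>\<^bsub>V\<^esub> (\<ominus>\<^bsub>V\<^esub> u \<oplus>\<^bsub>V\<^esub> \<ominus>\<^bsub>V\<^esub> (b \<odot>\<^bsub>V\<^esub> v))"
      by (simp only: eq)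
    also have "\<dots> = w \<ominus>\<^bsub>V\<^esub> u"
      using ab v c by (simp add: a_minus_def M.a_ac M.r_neg M.r_neg1 M.r_neg2)
    finally show ?thesis .
  qed
  with submodule_diff_closed[OF W uw(2,1)] have "(a \<ominus>\<^bsub>K\<^esub> b) \<odot>\<^bsub>V\<^esub> v \<in> W"
    by simp
  then have "a \<ominus>\<^bsub>K\<^esub> b = \<zero>\<^bsub>K\<^esub>"
    using smult_mem_submodule_iff[OF W _ v] ab \<open>v \<notin> W\<close> by (meson R.minus_closed)
  then have "a = b"
    using ab by simp
  with eq show ?thesis
    using ab v c by simp
qed

text \<open>Ordered tuples, built by prepending a vector outside the span of the tail: each stage of
  the recursion offers a known number of choices, which makes such lists easy to count.\<close>

primrec indep :: "'c list \<Rightarrow> bool" where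
  "indep [] \<longleftrightarrow> True"
| "indep (v # xs) \<longleftrightarrow> v \<in> carrier V \<and> v \<notin> span (set xs) \<and> indep xs"

lemma indep_carrier: "indep xs \<Longrightarrow> set xs \<subseteq> carrier V"
  by (induction xs) auto

lemma submodule_carrier: "submodule K (carrier V) V"
  by (rule submodule.intro) (auto intro: module_axioms)

lemma submodule_vimage:
  assumes "f \<in> module_hom K V V" "submodule K W V"
  shows "submodule K {v \<in> carrier V. f v \<in> W} V"
proof -
  interpret mod_hom K V V f
    by unfold_locales fact
  interpret submodule K W V by fact
  show ?thesis
    by (rule submodule.intro) (auto intro: module_axioms)
qed

text \<open>Serves twice: homs that agree on a list agree on its span, and an eigenspace is the
  equalizer of an operator and a scalar multiplication.\<close>

lemma submodule_equalizer:
  assumes "f \<in> module_hom K V V" "g \<in> module_hom K V V"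
  shows "submodule K {v \<in> carrier V. f v = g v} V"
proof -
  interpret f: mod_hom K V V f
    by unfold_locales fact
  interpret g: mod_hom K V V g
    by unfold_locales fact
  show ?thesis
    by (rule submodule.intro) (auto intro: module_axioms)
qed

lemma hom_eq_on_span:
  assumes "f \<in> module_hom K V V" "g \<in> module_hom K V V"
    and "set xs \<subseteq> carrier V" "map f xs = map g xs" "v \<in> span (set xs)"
  shows "f v = g v"
  using span_is_subset[OF _ submodule_equalizer[OF assms(1,2)], of "set xs"] assms(3-) by auto

lemma indep_nonzero: "indep xs \<Longrightarrow> \<zero>\<^bsub>V\<^esub> \<notin> set xs"
  by (induction xs) (auto simp: span_zero)

end

section \<open>Counting in finite vector spaces: spans, independent lists, subspaces\<close>

locale finite_vectorspace = vectorspace K V for K (structure) and V +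
  assumes finite_K: "finite (carrier K)" and finite_V: "finite (carrier V)"
begin

abbreviation q :: nat where "q \<equiv> card (carrier K)"

lemma q_gt_1: "q > 1"
proof -
  have "card {\<zero>\<^bsub>K\<^esub>, \<one>\<^bsub>K\<^esub>} \<le> q"
    using finite_K by (intro card_mono) auto
  then show ?thesis
    by simp
qed

lemma card_span_insert:
  assumes "v \<in> carrier V" "S \<subseteq> carrier V" "v \<notin> span S"
  shows "card (span (insert v S)) = q * card (span S)"
proof -
  have "inj_on (\<lambda>(a, u). a \<odot>\<^bsub>V\<^esub> v \<oplus>\<^bsub>V\<^esub> u) (carrier K \<times> span S)"
    using coeff_unique_mod_submodule[OF span_is_submodule[OF assms(2)] _ _ assms(1) _ _ _ assms(3)]
    by (auto simp: inj_on_def)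
  then show ?thesis
    using assms by (simp add: span_insert card_image card_cartesian_product)
qed

lemma card_span_indep: "indep xs \<Longrightarrow> card (span (set xs)) = q ^ length xs"
proof (induction xs)
  case Nil
  then show ?case by (simp add: span_empty)
next
  case (Cons v xs)
  then show ?case
    by (simp add: card_span_insert indep_carrier)
qed

lemma finite_submodule: "submodule K W V \<Longrightarrow> finite W"
  using finite_V submodule.subset finite_subset by metis

lemma length_indep_le:
  assumes "card (carrier V) = q ^ n" "indep xs"
  shows "length xs \<le> n"
proof -
  have "q ^ length xs \<le> q ^ n"
    using card_mono[OF finite_V span_is_subset2[OF indep_carrier[OF assms(2)]]] assms
    by (simp add: card_span_indep)
  then show ?thesis
    using q_gt_1 by simp
qed

text \<open>Counting replaces the exchange lemma: fewer than \<open>n\<close> independent vectors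
  span fewer than \<open>q ^ n\<close> elements, so some vector lies outside. New vectors go in
  front, whence \<open>ys @ xs\<close>.\<close>

lemma indep_extend:
  assumes "card (carrier V) = q ^ n" "indep xs"
  shows "\<exists>ys. indep (ys @ xs) \<and> length (ys @ xs) = n"
  using assms(2)
proof (induction "n - length xs" arbitrary: xs)
  case 0
  then have "length xs = n"
    using length_indep_le[OF assms(1) 0(2)] by linarith
  with 0(2) show ?case
    by (metis append_Nil)
next
  case (Suc d)
  from Suc.hyps(2) have len: "length xs < n" and d: "d = n - length (v # xs)" for v
    by auto
  have "q ^ length xs \<noteq> q ^ n"
    using len q_gt_1 by simp
  then have "span (set xs) \<noteq> carrier V"
    using card_span_indep[OF Suc.prems] assms(1) by metis
  then obtain v where v: "v \<in> carrier V" "v \<notin> span (set xs)"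
    using span_is_subset2[OF indep_carrier[OF Suc.prems]] by blast
  have "\<exists>ys. indep (ys @ v # xs) \<and> length (ys @ v # xs) = n"
    using v Suc.prems by (intro Suc.hyps(1)[OF d]) simp
  then obtain ys where "indep (ys @ v # xs)" "length (ys @ v # xs) = n"
    by blast
  then have "indep ((ys @ [v]) @ xs) \<and> length ((ys @ [v]) @ xs) = n"
    by simp
  then show ?case by blast
qed

lemma span_indep_eq:
  assumes "submodule K W V" "card W = q ^ length xs" "indep xs" "set xs \<subseteq> W"
  shows "span (set xs) = W"
  using assms by (intro card_subset_eq finite_submodule span_is_subset) (simp_all add: card_span_indep)

lemma finite_indep_lists:
  assumes "submodule K W V"
  shows "finite {xs. indep xs \<and> set xs \<subseteq> W \<and> length xs = k}"
  by (rule finite_subset[OF _ finite_lists_length_eq[of W k]]) (use assms finite_submodule in auto)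

text \<open>A list of length \<open>k\<close> spans \<open>q ^ k\<close> elements of
  \<open>W\<close>, and any of the remaining ones may be prepended. For \<open>k > n\<close> the
  factor at \<open>i = n\<close> vanishes, matching the absence of such lists.\<close>

lemma card_indep_lists:
  assumes W: "submodule K W V" and "card W = q ^ n"
  shows "card {xs. indep xs \<and> set xs \<subseteq> W \<and> length xs = k} = (\<Prod>i<k. q ^ n - q ^ i)"
proof (induction k)
  case 0
  have "{xs. indep xs \<and> set xs \<subseteq> W \<and> length xs = 0} = {[]}"
    by auto
  then show ?case by simp
next
  case (Suc k)
  let ?L = "\<lambda>k. {xs. indep xs \<and> set xs \<subseteq> W \<and> length xs = k}"
  have fin: "finite W"
    using W by (rule finite_submodule)
  have "bij_betw (\<lambda>(xs, v). v # xs) (SIGMA xs:?L k. W - span (set xs)) (?L (Suc k))"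
    using submodule.subset[OF W] by (intro bij_betwI[where g = "\<lambda>xs. (tl xs, hd xs)"]) (auto simp: length_Suc_conv)
  then have "card (?L (Suc k)) = card (SIGMA xs:?L k. W - span (set xs))"
    by (simp add: bij_betw_same_card)
  also have "\<dots> = (\<Sum>xs\<in>?L k. card (W - span (set xs)))"
    using fin finite_indep_lists[OF W] by (intro card_SigmaI) auto
  also have "\<dots> = (\<Sum>xs\<in>?L k. q ^ n - q ^ k)"
  proof (intro sum.cong refl)
    fix xs assume "xs \<in> ?L k"
    then show "card (W - span (set xs)) = q ^ n - q ^ k"
      using assms fin span_is_subset[OF _ W, of "set xs"]
      by (subst card_Diff_subset) (auto simp: card_span_indep intro: finite_subset)
  qed
  finally show ?case
    using Suc by simp
qed

lemma fin_dim: fin_dim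
  unfolding fin_dim_def
  using finite_V span_is_subset2[of "carrier V"] in_own_span[of "carrier V"]
  by (intro exI[of _ "carrier V"]) auto

text \<open>Each vector has unique coordinates in a basis \<open>B\<close>; restricting the
  coefficient functions to be extensional makes this a bijection with
  \<open>B \<rightarrow>\<^sub>E carrier K\<close>.\<close>

lemma card_eq_dim: "card (carrier V) = q ^ dim"
proof -
  obtain B where B: "finite B" "basis B"
    using finite_basis_exists[OF fin_dim] by blast
  then have sub: "B \<subseteq> carrier V"
    by (simp add: basis_def)
  have ex1: "\<exists>!a. a \<in> B \<rightarrow>\<^sub>E carrier K \<and> lincomb a B = v" if "v \<in> carrier V" for v
    using basis_criterion[OF B(1) sub] B(2) that by blast
  have "bij_betw (\<lambda>a. lincomb a B) (B \<rightarrow>\<^sub>E carrier K) (carrier V)"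
    unfolding bij_betw_def
  proof
    have *: "lincomb a B \<in> carrier V" if "a \<in> B \<rightarrow>\<^sub>E carrier K" for a
      using that sub by (intro lincomb_closed) auto
    show "inj_on (\<lambda>a. lincomb a B) (B \<rightarrow>\<^sub>E carrier K)"
      using ex1 * by (intro inj_onI) metis
    show "(\<lambda>a. lincomb a B) ` (B \<rightarrow>\<^sub>E carrier K) = carrier V"
      using ex1 * by blast
  qed
  then have "card (carrier V) = card (B \<rightarrow>\<^sub>E carrier K)"
    by (simp add: bij_betw_same_card)
  with B show ?thesis
    by (simp add: card_funcsetE dim_basis)
qed

text \<open>The bridge from the dimension in the definitions of codes and rank to cardinalities. The
  exponent can be read off because \<open>q > 1\<close>.\<close>

lemma dim_submodule_iff:
  assumes "submodule K W V"
  shows "vectorspace.dim K (V\<lparr>carrier := W\<rparr>) = k \<longleftrightarrow> card W = q ^ k"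
proof -
  have "subspace K W V"
    using assms by (simp add: subspace_def vectorspace_axioms)
  then interpret W: vectorspace K "V\<lparr>carrier := W\<rparr>"
    by (rule subspace_is_vs)
  interpret W: finite_vectorspace K "V\<lparr>carrier := W\<rparr>"
    by unfold_locales (use finite_K finite_submodule[OF assms] in auto)
  show ?thesis
    using W.card_eq_dim q_gt_1 by (auto simp: power_inject_exp)
qed

lemma card_submodule_power:
  assumes "submodule K W V"
  obtains d where "card W = q ^ d"
  using dim_submodule_iff[OF assms] by blast

text \<open>Double counting of pairs of a \<open>k\<close>-dimensional subspace and an ordered basis
  of it: the basis determines the subspace. The product form of the Gaussian binomial coefficient
  avoids division of naturals.\<close>

lemma card_subspaces:
  assumes V: "card (carrier V) = q ^ n"
  shows "card {W. submodule K W V \<and> card W = q ^ k} * (\<Prod>i<k. q ^ k - q ^ i) = (\<Prod>i<k. q ^ n - q ^ i)"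
proof -
  let ?S = "{W. submodule K W V \<and> card W = q ^ k}"
  let ?L = "\<lambda>W. {xs. indep xs \<and> set xs \<subseteq> W \<and> length xs = k}"
  have "?S \<subseteq> Pow (carrier V)"
    using submodule.subset by blast
  then have fin: "finite ?S"
    using finite_V by (meson finite_Pow_iff finite_subset)
  have "bij_betw snd (Sigma ?S ?L) (?L (carrier V))"
  proof (intro bij_betwI[where g = "\<lambda>xs. (span (set xs), xs)"])
    show "snd \<in> Sigma ?S ?L \<rightarrow> ?L (carrier V)"
      using submodule.subset by fastforce
    show "(\<lambda>xs. (span (set xs), xs)) \<in> ?L (carrier V) \<rightarrow> Sigma ?S ?L"
      by (auto simp: card_span_indep intro!: span_is_submodule dest: subsetD[OF in_own_span])
  qed (auto simp: span_indep_eq)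
  then have "card (?L (carrier V)) = card (Sigma ?S ?L)"
    by (simp add: bij_betw_same_card)
  also have "\<dots> = (\<Sum>W\<in>?S. card (?L W))"
    using fin finite_indep_lists by (intro card_SigmaI) auto
  also have "\<dots> = (\<Sum>W\<in>?S. \<Prod>i<k. q ^ k - q ^ i)"
    by (intro sum.cong) (auto simp: card_indep_lists)
  finally show ?thesis
    using card_indep_lists[OF submodule_carrier V] by simp
qed

end

section \<open>Eigenvalues in a full family of operators\<close>

text \<open>Expansion of the product of \<open>1 - 1\<close> over \<open>S\<close>, which is empty
  exactly when \<open>S\<close> is.\<close>

lemma sum_alternating_Pow:
  assumes "finite S"
  shows "(\<Sum>L\<in>Pow S. (-1) ^ card L) = (if S = {} then 1 else (0 :: real))"
  using prod_diff_conv_sum[OF assms, of "\<lambda>_. 1 :: real" "\<lambda>_. 1"] assms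
  by (simp add: card_gt_0_iff power_0_left split: if_splits)

text \<open>An abstract stand-in for the square matrices: faithfulness and the cardinality
  \<open>q ^ (n * n)\<close> together force \<open>M\<close> to represent every endomorphism of
  \<open>V\<close>.\<close>

locale full_operator_family = finite_vectorspace K V for K (structure) and V +
  fixes M :: "'m set" and act :: "'m \<Rightarrow> 'c \<Rightarrow> 'c" and n :: nat
  assumes act_hom: "A \<in> M \<Longrightarrow> act A \<in> module_hom K V V"
    and act_faithful: "A \<in> M \<Longrightarrow> B \<in> M \<Longrightarrow> (\<And>v. v \<in> carrier V \<Longrightarrow> act A v = act B v) \<Longrightarrow> A = B"
    and card_V: "card (carrier V) = q ^ n"
    and finite_M: "finite M"
    and card_M: "card M = q ^ (n * n)"
begin

section \<open>Operators determined by their values on a basis\<close>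

lemma act_closed: "A \<in> M \<Longrightarrow> v \<in> carrier V \<Longrightarrow> act A v \<in> carrier V"
  using act_hom[of A] by (auto simp: module_hom_def)

lemma act_add: "A \<in> M \<Longrightarrow> v \<in> carrier V \<Longrightarrow> w \<in> carrier V \<Longrightarrow>
    act A (v \<oplus>\<^bsub>V\<^esub> w) = act A v \<oplus>\<^bsub>V\<^esub> act A w"
  using act_hom[of A] by (auto simp: module_hom_def)

lemma act_smult: "A \<in> M \<Longrightarrow> a \<in> carrier K \<Longrightarrow> v \<in> carrier V \<Longrightarrow>
    act A (a \<odot>\<^bsub>V\<^esub> v) = a \<odot>\<^bsub>V\<^esub> act A v"
  using act_hom[of A] by (auto simp: module_hom_def)

lemma act_zero: "A \<in> M \<Longrightarrow> act A \<zero>\<^bsub>V\<^esub> = \<zero>\<^bsub>V\<^esub>"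
  using act_smult[of A \<zero> "\<zero>\<^bsub>V\<^esub>"] act_closed[of A "\<zero>\<^bsub>V\<^esub>"] by simp

text \<open>Injective since a hom is determined on a spanning list and the action is faithful;
  surjective since both sides have \<open>q ^ (n * n)\<close> elements.\<close>

lemma bij_betw_basis_values:
  assumes "indep xs" "length xs = n"
  shows "bij_betw (\<lambda>A. map (act A) xs) M {ws. set ws \<subseteq> carrier V \<and> length ws = n}"
proof -
  have sub: "set xs \<subseteq> carrier V"
    using assms by (simp add: indep_carrier)
  have span: "span (set xs) = carrier V"
    using assms sub by (intro span_indep_eq submodule_carrier) (auto simp: card_V)
  have inj: "inj_on (\<lambda>A. map (act A) xs) M"
  proof (rule inj_onI)
    fix A B assume AB: "A \<in> M" "B \<in> M" "map (act A) xs = map (act B) xs"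
    show "A = B"
    proof (rule act_faithful[OF AB(1,2)])
      fix v assume "v \<in> carrier V"
      with span show "act A v = act B v"
        by (intro hom_eq_on_span[OF act_hom[OF AB(1)] act_hom[OF AB(2)] sub AB(3)]) simp
    qed
  qed
  have "card ((\<lambda>A. map (act A) xs) ` M) = card {ws. set ws \<subseteq> carrier V \<and> length ws = n}"
    using inj by (simp add: card_image card_M card_lists_length_eq finite_V card_V power_mult)
  then have "(\<lambda>A. map (act A) xs) ` M = {ws. set ws \<subseteq> carrier V \<and> length ws = n}"
    using assms sub by (intro card_subset_eq finite_lists_length_eq finite_V) (auto intro!: act_closed)
  with inj show ?thesis
    by (simp add: bij_betw_def)
qed

text \<open>Turns the linear map hidden in an MRD code into an actual matrix: the operator with the
  same values on a basis exists by the preceding bijection.\<close>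

lemma hom_represented:
  assumes "f \<in> module_hom K V V"
  obtains A where "A \<in> M" "\<And>v. v \<in> carrier V \<Longrightarrow> act A v = f v"
proof -
  obtain xs where xs: "indep xs" "length xs = n"
    using indep_extend[OF card_V, of "[]"] by (metis append_Nil2 indep.simps(1))
  have sub: "set xs \<subseteq> carrier V"
    using xs by (simp add: indep_carrier)
  have span: "span (set xs) = carrier V"
    using xs sub by (intro span_indep_eq submodule_carrier) (auto simp: card_V)
  have "set (map f xs) \<subseteq> carrier V"
    using module_hom_closed[OF assms] sub by auto
  then have "map f xs \<in> (\<lambda>A. map (act A) xs) ` M"
    unfolding bij_betw_imp_surj_on[OF bij_betw_basis_values[OF xs]] using xs(2) by simp
  then obtain A where A: "map f xs = map (act A) xs" "A \<in> M"
    by (rule imageE)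
  show ?thesis
  proof (rule that[OF A(2)])
    fix v assume "v \<in> carrier V"
    with span show "act A v = f v"
      by (intro hom_eq_on_span[OF act_hom[OF A(2)] assms sub A(1)[symmetric]]) simp
  qed
qed

text \<open>After \<open>xs\<close> is completed to a basis by \<open>ys\<close>, the values on
  \<open>ys\<close> remain free, and there are \<open>n - length xs\<close> of them.\<close>

lemma card_prescribed_values:
  assumes "indep xs" "set ws \<subseteq> carrier V" "length ws = length xs"
  shows "card {A \<in> M. map (act A) xs = ws} = q ^ (n * (n - length xs))"
proof -
  obtain ys where ys: "indep (ys @ xs)" "length (ys @ xs) = n"
    using indep_extend[OF card_V assms(1)] by blast
  let ?Z = "{zs. set zs \<subseteq> carrier V \<and> length zs = n - length xs}"
  have bij: "bij_betw (\<lambda>A. map (act A) (ys @ xs)) M {ws. set ws \<subseteq> carrier V \<and> length ws = n}"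
    using ys by (rule bij_betw_basis_values)
  have "bij_betw (\<lambda>A. map (act A) ys) {A \<in> M. map (act A) xs = ws} ?Z"
    unfolding bij_betw_def
  proof
    show "inj_on (\<lambda>A. map (act A) ys) {A \<in> M. map (act A) xs = ws}"
      using bij by (auto simp: bij_betw_def inj_on_def)
    show "(\<lambda>A. map (act A) ys) ` {A \<in> M. map (act A) xs = ws} = ?Z"
    proof (intro equalityI subsetI)
      fix zs assume zs: "zs \<in> ?Z"
      then have "zs @ ws \<in> (\<lambda>A. map (act A) (ys @ xs)) ` M"
        using bij assms ys by (auto simp: bij_betw_def)
      then obtain A where "A \<in> M" "zs @ ws = map (act A) ys @ map (act A) xs"
        by auto
      moreover have "length zs = length ys"
        using zs ys by auto
      ultimately show "zs \<in> (\<lambda>A. map (act A) ys) ` {A \<in> M. map (act A) xs = ws}"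
        by auto
    qed (use ys indep_carrier[OF ys(1)] in \<open>auto intro!: act_closed\<close>)
  qed
  then show ?thesis
    by (simp add: bij_betw_same_card card_lists_length_eq finite_V card_V power_mult)
qed

section \<open>Eigenvector tuples and their independence\<close>

definition eigvecs :: "'m \<Rightarrow> 'a \<Rightarrow> 'c set" where
  "eigvecs A l = {v \<in> carrier V. v \<noteq> \<zero>\<^bsub>V\<^esub> \<and> act A v = l \<odot>\<^bsub>V\<^esub> v}"

text \<open>Scalars may repeat in \<open>ls\<close>: the list \<open>l # ls\<close> with
  \<open>l\<close> already in \<open>ls\<close> later records a second eigenvector for the same
  eigenvalue.\<close>

definition eigvec_lists :: "'m \<Rightarrow> 'a list \<Rightarrow> 'c list set" where
  "eigvec_lists A ls = {xs. list_all2 (\<lambda>l v. v \<in> eigvecs A l) ls xs}"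

definition eigvals :: "'m \<Rightarrow> 'a set" where
  "eigvals A = {l \<in> carrier K. eigvecs A l \<noteq> {}}"

lemma finite_eigvecs: "finite (eigvecs A l)"
  using finite_V by (simp add: eigvecs_def)

lemma finite_eigvals: "finite (eigvals A)"
  using finite_K by (simp add: eigvals_def)

lemma eigvec_lists_Nil: "eigvec_lists A [] = {[]}"
  by (auto simp: eigvec_lists_def)

lemma eigvec_lists_Cons: "eigvec_lists A (l # ls) = (\<lambda>(x, xs). x # xs) ` (eigvecs A l \<times> eigvec_lists A ls)"
  by (auto simp: eigvec_lists_def list_all2_Cons1)

lemma card_eigvec_lists: "card (eigvec_lists A ls) = (\<Prod>l\<leftarrow>ls. card (eigvecs A l))"
proof (induction ls)
  case (Cons l ls)
  have "inj_on (\<lambda>(x, xs). x # xs) (eigvecs A l \<times> eigvec_lists A ls)"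
    by (auto simp: inj_on_def)
  with Cons show ?case
    by (simp add: eigvec_lists_Cons card_image card_cartesian_product)
qed (simp add: eigvec_lists_Nil)

lemma finite_eigvec_lists: "finite (eigvec_lists A ls)"
  by (induction ls) (auto simp: eigvec_lists_Nil eigvec_lists_Cons finite_eigvecs)

lemma eigvec_lists_carrier: "xs \<in> eigvec_lists A ls \<Longrightarrow> set xs \<subseteq> carrier V"
  by (induction ls arbitrary: xs) (fastforce simp: eigvec_lists_Nil eigvec_lists_Cons eigvecs_def)+

lemma length_eigvec_lists: "xs \<in> eigvec_lists A ls \<Longrightarrow> length xs = length ls"
  by (auto simp: eigvec_lists_def dest: list_all2_lengthD)

text \<open>The preimage of the span under \<open>act A\<close> is a submodule containing every
  entry of \<open>xs\<close>, hence containing the span.\<close>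

lemma span_eigvecs_invariant:
  assumes "A \<in> M" "xs \<in> eigvec_lists A ls" "set ls \<subseteq> carrier K" "u \<in> span (set xs)"
  shows "act A u \<in> span (set xs)"
proof -
  have sub: "set xs \<subseteq> carrier V"
    using assms by (simp add: eigvec_lists_carrier)
  have S: "submodule K (span (set xs)) V"
    using sub by (rule span_is_submodule)
  have "act A x \<in> span (set xs)" if x: "x \<in> set xs" for x
  proof -
    obtain i where i: "i < length xs" "x = xs ! i"
      using x by (auto simp: in_set_conv_nth)
    then have "ls ! i \<in> set ls" "act A x = ls ! i \<odot>\<^bsub>V\<^esub> x"
      using assms(2) by (auto simp: eigvec_lists_def eigvecs_def list_all2_conv_all_nth)
    then show ?thesis
      using x assms(3) submodule.smult_closed[OF S] in_own_span[OF sub] by auto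
  qed
  then have "span (set xs) \<subseteq> {v \<in> carrier V. act A v \<in> span (set xs)}"
    using sub by (intro span_is_subset submodule_vimage act_hom assms S) auto
  with assms show ?thesis by blast
qed

text \<open>As \<open>ls\<close> is distinct, the set on the right has at most one element. When it
  is empty, this yields independence of eigenvectors; when it is a singleton, it says that an
  eigenspace meets the span of the tuple only in a line.\<close>

lemma eigvec_in_span_eigvecs:
  assumes "A \<in> M" "l \<in> carrier K"
    and "xs \<in> eigvec_lists A ls" "indep xs" "distinct ls" "set ls \<subseteq> carrier K"
    and "w \<in> span (set xs)" "act A w = l \<odot>\<^bsub>V\<^esub> w"
  shows "w \<in> span {x. (l, x) \<in> set (zip ls xs)}"
  using assms(3-)
proof (induction ls arbitrary: xs w)
  case Nil
  then show ?case by (simp add: eigvec_lists_Nil)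
next
  case (Cons l' ls)
  then obtain y ys where xs: "xs = y # ys" "ys \<in> eigvec_lists A ls" and y: "y \<in> carrier V" "act A y = l' \<odot>\<^bsub>V\<^esub> y"
    by (auto simp: eigvec_lists_Cons eigvecs_def)
  have ys: "set ys \<subseteq> carrier V" "y \<notin> span (set ys)" "indep ys"
    using Cons.prems xs indep_carrier by auto
  have S: "submodule K (span (set ys)) V"
    using ys by (intro span_is_submodule)
  obtain c u where w: "c \<in> carrier K" "u \<in> span (set ys)" "w = c \<odot>\<^bsub>V\<^esub> y \<oplus>\<^bsub>V\<^esub> u"
    using Cons.prems xs y ys by (auto simp: span_insert)
  have u: "u \<in> carrier V"
    using w ys span_is_subset2 by blast
  have l': "l' \<in> carrier K"
    using Cons.prems by simp
  have Au: "act A u \<in> span (set ys)"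
    using Cons.prems xs w by (intro span_eigvecs_invariant[OF assms(1) xs(2)]) auto
  have lu: "l \<odot>\<^bsub>V\<^esub> u \<in> span (set ys)"
    using w assms S by (metis submodule.smult_closed)
  \<comment> \<open>Two expansions of \<open>act A w\<close> along \<open>y\<close> with remainder
    in the invariant subspace \<open>span (set ys)\<close>; coefficients and remainders must agree
    separately.\<close>
  have "(c \<otimes> l') \<odot>\<^bsub>V\<^esub> y \<oplus>\<^bsub>V\<^esub> act A u = act A w"
    using w u y l' assms by (simp add: act_add act_smult smult_assoc1)
  also have "\<dots> = (l \<otimes> c) \<odot>\<^bsub>V\<^esub> y \<oplus>\<^bsub>V\<^esub> l \<odot>\<^bsub>V\<^esub> u"
    using Cons.prems w u y assms by (simp add: smult_r_distr smult_assoc1)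
  finally have "c \<otimes> l' = l \<otimes> c \<and> act A u = l \<odot>\<^bsub>V\<^esub> u"
    using w l' assms by (intro coeff_unique_mod_submodule[OF S _ _ y(1) Au lu _ ys(2)]) auto
  then have eq: "c \<otimes> l' = l \<otimes> c" "act A u = l \<odot>\<^bsub>V\<^esub> u"
    by auto
  have IH: "u \<in> span {x. (l, x) \<in> set (zip ls ys)}"
    using Cons xs ys w eq by auto
  show ?case
  proof (cases "l = l'")
    case True
    \<comment> \<open>The scalar \<open>l\<close> occurs only at the head, so the induction
      hypothesis forces \<open>u\<close> to be zero and \<open>w\<close> is a multiple of
      \<open>y\<close>.\<close>
    with Cons.prems have "{x. (l, x) \<in> set (zip ls ys)} = {}" "{x. (l, x) \<in> set (zip (l' # ls) xs)} = {y}"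
      by (auto simp: xs dest: set_zip_leftD)
    with IH w y show ?thesis
      by (auto simp: span_empty span_singleton)
  next
    case False
    have "c = \<zero>"
    proof (rule ccontr)
      assume "c \<noteq> \<zero>"
      moreover have "c \<otimes> l' = c \<otimes> l"
        using eq w assms by (simp add: R.m_comm)
      ultimately show False
        using False w l' assms m_lcancel by blast
    qed
    moreover have "{x. (l, x) \<in> set (zip (l' # ls) xs)} = {x. (l, x) \<in> set (zip ls ys)}"
      using False xs by auto
    ultimately show ?thesis
      using IH w y u by simp
  qed
qed

text \<open>An eigenvector for a new scalar inside the span of the others would lie in the span of
  the empty set, hence be zero.\<close>

lemma indep_eigvecs:
  assumes "A \<in> M" "xs \<in> eigvec_lists A ls" "distinct ls" "set ls \<subseteq> carrier K"
  shows "indep xs"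
  using assms(2-)
proof (induction ls arbitrary: xs)
  case Nil
  then show ?case by (simp add: eigvec_lists_Nil)
next
  case (Cons l ls)
  then obtain y ys where xs: "xs = y # ys" "ys \<in> eigvec_lists A ls"
    and y: "y \<in> carrier V" "y \<noteq> \<zero>\<^bsub>V\<^esub>" "act A y = l \<odot>\<^bsub>V\<^esub> y"
    by (auto simp: eigvec_lists_Cons eigvecs_def)
  have ys: "indep ys"
    using Cons xs by simp
  have "y \<notin> span (set ys)"
  proof
    assume "y \<in> span (set ys)"
    then have "y \<in> span {x. (l, x) \<in> set (zip ls ys)}"
      using Cons.prems xs y ys assms(1) by (intro eigvec_in_span_eigvecs) auto
    moreover have "{x. (l, x) \<in> set (zip ls ys)} = {}"
      using Cons.prems by (auto dest: set_zip_leftD)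
    ultimately show False
      using y by (simp add: span_empty)
  qed
  with xs y ys show ?case by simp
qed

text \<open>One eigenvector per eigenvalue gives an independent list. This bound truncates the
  inclusion-exclusion sum.\<close>

lemma card_eigvals_le:
  assumes "A \<in> M"
  shows "card (eigvals A) \<le> n"
proof -
  obtain ls where ls: "set ls = eigvals A" "distinct ls"
    using finite_distinct_list[OF finite_eigvals] by blast
  \<comment> \<open>The product formula for the cardinality stands in for choosing the eigenvectors
    one by one.\<close>
  have "card (eigvec_lists A ls) \<noteq> 0"
    using ls by (auto simp: card_eigvec_lists prod_list_zero_iff eigvals_def finite_eigvecs)
  then obtain xs where xs: "xs \<in> eigvec_lists A ls"
    by fastforce
  then have "indep xs"
    using ls assms by (intro indep_eigvecs[of A xs ls]) (auto simp: eigvals_def)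
  then have "length xs \<le> n"
    using card_V by (rule length_indep_le[rotated])
  with xs ls show ?thesis
    by (metis distinct_card length_eigvec_lists)
qed

section \<open>Sizes of eigenspaces and the cost of large ones\<close>

lemma submodule_eigenspace:
  assumes "A \<in> M" "l \<in> carrier K"
  shows "submodule K (insert \<zero>\<^bsub>V\<^esub> (eigvecs A l)) V"
proof -
  have "(\<lambda>v. l \<odot>\<^bsub>V\<^esub> v) \<in> module_hom K V V"
    using assms by (auto simp: module_hom_def smult_r_distr smult_assoc1[symmetric] R.m_comm)
  from submodule_equalizer[OF act_hom[OF assms(1)] this]
  have "submodule K {v \<in> carrier V. act A v = l \<odot>\<^bsub>V\<^esub> v} V" .
  moreover have "{v \<in> carrier V. act A v = l \<odot>\<^bsub>V\<^esub> v} = insert \<zero>\<^bsub>V\<^esub> (eigvecs A l)"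
    using assms by (auto simp: eigvecs_def act_zero)
  ultimately show ?thesis by simp
qed

text \<open>With its zero, the eigenspace has \<open>q ^ d\<close> elements, \<open>d > 0\<close>.
  For \<open>d \<ge> 2\<close> the bound \<open>2 * (q - 1)\<close> is crude, but it leaves a
  surplus of \<open>q - 1\<close> eigenvectors outside any single line.\<close>

lemma card_eigvecs_cases:
  assumes "A \<in> M" "l \<in> eigvals A"
  shows "card (eigvecs A l) = q - 1 \<or> card (eigvecs A l) \<ge> 2 * (q - 1)"
proof -
  have l: "l \<in> carrier K" "eigvecs A l \<noteq> {}"
    using assms by (auto simp: eigvals_def)
  obtain d where d: "card (insert \<zero>\<^bsub>V\<^esub> (eigvecs A l)) = q ^ d"
    using card_submodule_power[OF submodule_eigenspace[OF assms(1) l(1)]] .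
  have z: "\<zero>\<^bsub>V\<^esub> \<notin> eigvecs A l"
    by (simp add: eigvecs_def)
  with d finite_eigvecs have c: "Suc (card (eigvecs A l)) = q ^ d"
    by simp
  have "d \<noteq> 0"
    using c l finite_eigvecs by (auto simp: card_eq_0_iff)
  then consider "d = 1" | "d \<ge> 2" by linarith
  then show ?thesis
  proof cases
    case 1
    with c have "q = Suc (card (eigvecs A l))" by simp
    then show ?thesis by linarith
  next
    case 2
    have "2 * q \<le> q * q"
      using q_gt_1 by simp
    also have "\<dots> \<le> q ^ d"
      using 2 q_gt_1 power_increasing[of 2 d q] by (simp add: power2_eq_square)
    finally show ?thesis
      using c by linarith
  qed
qed

lemma card_eigvec_lists_ge:
  assumes "A \<in> M" "set ls \<subseteq> eigvals A"
  shows "(q - 1) ^ length ls \<le> card (eigvec_lists A ls)"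
  using assms(2)
proof (induction ls)
  case (Cons l ls)
  have "q - 1 \<le> card (eigvecs A l)"
    using card_eigvecs_cases[OF assms(1), of l] Cons.prems by auto
  with Cons show ?case
    by (auto simp: card_eigvec_lists intro: mult_mono)
qed (simp add: eigvec_lists_Nil)

text \<open>The eigenspace of \<open>l\<close> meets the span of a tuple only in the line through
  the entry belonging to \<open>l\<close>. This rules out at most \<open>q - 1\<close> eigenvectors;
  each of the others can be prepended.\<close>

lemma card_indep_eigvec_lists_Cons_ge:
  assumes "A \<in> M" "distinct ls" "set ls \<subseteq> carrier K" "l \<in> set ls"
  shows "card (eigvec_lists A ls) * (card (eigvecs A l) - (q - 1))
    \<le> card {xs \<in> eigvec_lists A (l # ls). indep xs}"
proof -
  let ?S = "SIGMA xs:eigvec_lists A ls. eigvecs A l - span (set xs)"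
  have indep: "indep xs" if "xs \<in> eigvec_lists A ls" for xs
    using indep_eigvecs assms that by blast
  have "card (eigvecs A l) - (q - 1) \<le> card (eigvecs A l - span (set xs))" if xs: "xs \<in> eigvec_lists A ls" for xs
  proof -
    obtain i where i: "i < length ls" "l = ls ! i"
      using assms by (auto simp: in_set_conv_nth)
    have len: "length xs = length ls"
      using xs by (rule length_eigvec_lists)
    \<comment> \<open>Distinctness of \<open>ls\<close> leaves exactly one entry attached to
      \<open>l\<close>.\<close>
    have zip: "{x. (l, x) \<in> set (zip ls xs)} = {xs ! i}"
      using assms(2) i len by (auto simp: in_set_zip nth_eq_iff_index_eq)
    have xi: "xs ! i \<in> carrier V"
      using eigvec_lists_carrier[OF xs] i len by (auto intro: subsetD)
    have sub: "eigvecs A l \<inter> span (set xs) \<subseteq> span {xs ! i} - {\<zero>\<^bsub>V\<^esub>}"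
      using eigvec_in_span_eigvecs[OF assms(1) _ xs indep[OF xs] assms(2,3), of l] assms(3,4)
      by (auto simp: eigvecs_def zip)
    have fin: "finite (span {xs ! i})"
      using xi by (intro finite_submodule span_is_submodule) auto
    have "card (span {xs ! i}) \<le> q"
      using xi finite_K by (simp add: span_singleton card_image_le)
    then have "card (span {xs ! i} - {\<zero>\<^bsub>V\<^esub>}) \<le> q - 1"
      using span_zero[of "{xs ! i}"] fin by (simp add: card_Diff_singleton)
    with card_mono[OF _ sub] fin have "card (eigvecs A l \<inter> span (set xs)) \<le> q - 1"
      by fastforce
    then show ?thesis
      using finite_eigvecs by (subst card_Diff_subset_Int) auto
  qed
  then have "card (eigvec_lists A ls) * (card (eigvecs A l) - (q - 1)) \<le> card ?S"
    using finite_eigvec_lists finite_eigvecs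
    by (subst card_SigmaI) (auto intro: order.trans[OF _ sum_mono[of _ "\<lambda>_. card (eigvecs A l) - (q - 1)"]])
  also have "\<dots> = card ((\<lambda>(xs, x). x # xs) ` ?S)"
    by (rule card_image[symmetric]) (auto simp: inj_on_def)
  also have "\<dots> \<le> card {xs \<in> eigvec_lists A (l # ls). indep xs}"
  proof (rule card_mono)
    show "finite {xs \<in> eigvec_lists A (l # ls). indep xs}"
      by (simp add: finite_eigvec_lists)
    show "(\<lambda>(xs, x). x # xs) ` ?S \<subseteq> {xs \<in> eigvec_lists A (l # ls). indep xs}"
      using indep by (auto simp: eigvec_lists_Cons eigvecs_def)
  qed
  finally show ?thesis .
qed

text \<open>
  An eigenspace of dimension at least 2 makes the number of eigenvector tuples exceed
  $(q-1)^j$, but then each tuple also extends by at least $q-1$ further independent eigenvectors; this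
  pays for the excess, and on average over all operators the extended tuples are rare.
\<close>

lemma card_eigvec_lists_le:
  assumes "A \<in> M" "distinct ls" "set ls \<subseteq> eigvals A"
  shows "(q - 1) * card (eigvec_lists A ls) \<le> (q - 1) ^ Suc (length ls) +
    (\<Sum>l\<in>set ls. card {xs \<in> eigvec_lists A (l # ls). indep xs})"
proof (cases "\<forall>l\<in>set ls. card (eigvecs A l) = q - 1")
  case True
  then have "card (eigvec_lists A ls) = (q - 1) ^ length ls"
    unfolding card_eigvec_lists by (induction ls) auto
  then show ?thesis by simp
next
  case False
  then obtain l where l: "l \<in> set ls" "card (eigvecs A l) \<noteq> q - 1"
    by blast
  then have "q - 1 \<le> card (eigvecs A l) - (q - 1)"
    using card_eigvecs_cases[OF assms(1), of l] assms(3) by auto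
  then have "(q - 1) * card (eigvec_lists A ls) \<le> card (eigvec_lists A ls) * (card (eigvecs A l) - (q - 1))"
    by simp
  also have "\<dots> \<le> card {xs \<in> eigvec_lists A (l # ls). indep xs}"
    using assms l by (intro card_indep_eigvec_lists_Cons_ge) (auto simp: eigvals_def)
  also have "\<dots> \<le> (\<Sum>l\<in>set ls. card {xs \<in> eigvec_lists A (l # ls). indep xs})"
    using l by (intro member_le_sum) auto
  finally show ?thesis by simp
qed

text \<open>Exchange of summation: for a fixed independent \<open>xs\<close>, having these
  eigenvectors prescribes the values of the operator on \<open>xs\<close>. Repetitions in
  \<open>ls\<close> are allowed, so the count also covers the extended tuples for
  \<open>l # ls\<close>.\<close>

lemma sum_card_indep_eigvec_lists:
  assumes "set ls \<subseteq> carrier K"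
  shows "(\<Sum>A\<in>M. card {xs \<in> eigvec_lists A ls. indep xs}) =
    (\<Prod>i<length ls. q ^ n - q ^ i) * q ^ (n * (n - length ls))"
proof -
  let ?L = "{xs. indep xs \<and> set xs \<subseteq> carrier V \<and> length xs = length ls}"
  have fin: "finite ?L"
    by (rule finite_indep_lists[OF submodule_carrier])
  have "{xs \<in> eigvec_lists A ls. indep xs} = {xs. xs \<in> ?L \<and> xs \<in> eigvec_lists A ls}" for A
    using eigvec_lists_carrier length_eigvec_lists by blast
  then have "(\<Sum>A\<in>M. card {xs \<in> eigvec_lists A ls. indep xs}) =
      (\<Sum>A\<in>M. \<Sum>xs\<in>{xs. xs \<in> ?L \<and> xs \<in> eigvec_lists A ls}. 1)"
    by simp
  also have "\<dots> = (\<Sum>xs\<in>?L. \<Sum>A\<in>{A. A \<in> M \<and> xs \<in> eigvec_lists A ls}. 1)"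
    by (rule sum.swap_restrict[OF finite_M fin])
  also have "\<dots> = (\<Sum>xs\<in>?L. q ^ (n * (n - length ls)))"
  proof (rule sum.cong[OF refl])
    fix xs assume xs: "xs \<in> ?L"
    let ?ws = "map2 (\<lambda>l x. l \<odot>\<^bsub>V\<^esub> x) ls xs"
    have len: "length xs = length ls"
      using xs by simp
    have nth: "xs ! i \<in> carrier V" "xs ! i \<noteq> \<zero>\<^bsub>V\<^esub>" if "i < length ls" for i
    proof -
      have "xs ! i \<in> set xs"
        using that len by simp
      then show "xs ! i \<in> carrier V" "xs ! i \<noteq> \<zero>\<^bsub>V\<^esub>"
        using xs indep_nonzero[of xs] by auto
    qed
    \<comment> \<open>Entries of an independent list are nonzero, so only the eigenvalue equations
      remain.\<close>
    have "xs \<in> eigvec_lists A ls \<longleftrightarrow> map (act A) xs = ?ws" for A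
      by (simp add: eigvec_lists_def eigvecs_def list_all2_conv_all_nth list_eq_iff_nth_eq len nth)
    moreover have "set ?ws \<subseteq> carrier V"
    proof
      fix w assume "w \<in> set ?ws"
      then obtain i where "i < length ls" "w = ls ! i \<odot>\<^bsub>V\<^esub> xs ! i"
        by (auto simp: set_zip len)
      moreover from this have "ls ! i \<in> carrier K"
        using assms nth_mem by blast
      ultimately show "w \<in> carrier V"
        using nth by simp
    qed
    ultimately show "(\<Sum>A\<in>{A. A \<in> M \<and> xs \<in> eigvec_lists A ls}. 1) = q ^ (n * (n - length ls))"
      using xs card_prescribed_values[of xs ?ws] len by simp
  qed
  finally show ?thesis
    by (simp add: card_indep_lists[OF submodule_carrier card_V])
qed

section \<open>Operators with prescribed eigenvalues: estimates and inclusion-exclusion\<close>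

definition eigvals_count :: "'a set \<Rightarrow> nat" where
  "eigvals_count L = card {A \<in> M. L \<subseteq> eigvals A}"

text \<open>For distinct scalars every eigenvector tuple is independent, and an operator lacking one
  of the eigenvalues has no tuple at all.\<close>

lemma sum_card_eigvec_lists:
  assumes "distinct ls" "set ls \<subseteq> carrier K"
  shows "(\<Sum>A\<in>{A \<in> M. set ls \<subseteq> eigvals A}. card (eigvec_lists A ls)) =
    (\<Prod>i<length ls. q ^ n - q ^ i) * q ^ (n * (n - length ls))"
proof -
  have "(\<Sum>A\<in>{A \<in> M. set ls \<subseteq> eigvals A}. card (eigvec_lists A ls)) =
      (\<Sum>A\<in>M. card {xs \<in> eigvec_lists A ls. indep xs})"
  proof (rule sum.mono_neutral_cong_left[OF finite_M])
    show "\<forall>A\<in>M - {A \<in> M. set ls \<subseteq> eigvals A}. card {xs \<in> eigvec_lists A ls. indep xs} = 0"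
    proof
      fix A assume A: "A \<in> M - {A \<in> M. set ls \<subseteq> eigvals A}"
      then obtain l where l: "l \<in> set ls" "eigvecs A l = {}"
        using assms by (auto simp: eigvals_def)
      then have "card (eigvec_lists A ls) = 0"
        by (auto simp: card_eigvec_lists prod_list_zero_iff intro!: rev_image_eqI[of l])
      then show "card {xs \<in> eigvec_lists A ls. indep xs} = 0"
        using finite_eigvec_lists by simp
    qed
  next
    fix A assume A: "A \<in> {A \<in> M. set ls \<subseteq> eigvals A}"
    then have "{xs \<in> eigvec_lists A ls. indep xs} = eigvec_lists A ls"
      using assms indep_eigvecs by blast
    then show "card (eigvec_lists A ls) = card {xs \<in> eigvec_lists A ls. indep xs}"
      by simp
  qed auto
  then show ?thesis
    using sum_card_indep_eigvec_lists[OF assms(2)] by simp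
qed

text \<open>Each operator that counts here carries at least \<open>(q - 1) ^ length ls\<close>
  eigenvector tuples.\<close>

lemma eigvals_count_upper:
  assumes "distinct ls" "set ls \<subseteq> carrier K"
  shows "(q - 1) ^ length ls * eigvals_count (set ls) \<le>
    (\<Prod>i<length ls. q ^ n - q ^ i) * q ^ (n * (n - length ls))"
proof -
  have "(q - 1) ^ length ls * eigvals_count (set ls) =
      (\<Sum>A\<in>{A \<in> M. set ls \<subseteq> eigvals A}. (q - 1) ^ length ls)"
    by (simp add: eigvals_count_def)
  also have "\<dots> \<le> (\<Sum>A\<in>{A \<in> M. set ls \<subseteq> eigvals A}. card (eigvec_lists A ls))"
    by (intro sum_mono card_eigvec_lists_ge) auto
  finally show ?thesis
    using sum_card_eigvec_lists[OF assms] by simp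
qed

lemma prod_power_diff_le: "(\<Prod>i<k. q ^ n - q ^ i) * q ^ (n * (n - k)) \<le> q ^ (n * n)"
proof (cases "k \<le> n")
  case True
  have "(\<Prod>i<k. q ^ n - q ^ i) * q ^ (n * (n - k)) \<le> (\<Prod>i<k. q ^ n) * q ^ (n * (n - k))"
    by (intro mult_right_mono prod_mono) auto
  also have "\<dots> = q ^ (n * n)"
    using True by (simp flip: power_mult power_add add: distrib_left[symmetric])
  finally show ?thesis .
next
  case False
  \<comment> \<open>The truncated exponent \<open>n - k\<close> is harmless because the factor at
    \<open>i = n\<close> is zero. This case arises when a tuple of length \<open>n\<close> is
    extended by one vector.\<close>
  then have "(\<Prod>i<k. q ^ n - q ^ i) = 0"
    by (intro prod_zero) (auto intro!: bexI[of _ n])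
  then show ?thesis by (simp only: mult_zero_left zero_le)
qed

text \<open>The pointwise estimate for large eigenspaces, summed over operators. Each scalar in
  \<open>ls\<close> costs at most \<open>q ^ (n * n)\<close>, against a main term larger by a factor
  of about \<open>q - 1\<close>; keeping that factor on the left avoids division.\<close>

lemma eigvals_count_lower:
  assumes "distinct ls" "set ls \<subseteq> carrier K"
  shows "(q - 1) * ((\<Prod>i<length ls. q ^ n - q ^ i) * q ^ (n * (n - length ls))) \<le>
    (q - 1) ^ Suc (length ls) * eigvals_count (set ls) + length ls * q ^ (n * n)"
proof -
  let ?M = "{A \<in> M. set ls \<subseteq> eigvals A}"
  let ?c = "\<lambda>l A. card {xs \<in> eigvec_lists A (l # ls). indep xs}"
  have "(q - 1) * ((\<Prod>i<length ls. q ^ n - q ^ i) * q ^ (n * (n - length ls))) =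
      (\<Sum>A\<in>?M. (q - 1) * card (eigvec_lists A ls))"
    by (simp only: sum_card_eigvec_lists[OF assms, symmetric] sum_distrib_left)
  also have "\<dots> \<le> (\<Sum>A\<in>?M. (q - 1) ^ Suc (length ls) + (\<Sum>l\<in>set ls. ?c l A))"
    using assms by (intro sum_mono card_eigvec_lists_le) auto
  also have "\<dots> = (q - 1) ^ Suc (length ls) * eigvals_count (set ls) + (\<Sum>A\<in>?M. \<Sum>l\<in>set ls. ?c l A)"
    by (simp only: sum.distrib sum_constant) (simp add: eigvals_count_def)
  \<comment> \<open>Enlarging to all operators makes the exact total for independent tuples
    applicable.\<close>
  also have "(\<Sum>A\<in>?M. \<Sum>l\<in>set ls. ?c l A) \<le> (\<Sum>A\<in>M. \<Sum>l\<in>set ls. ?c l A)"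
    using finite_M by (intro sum_mono2) auto
  also have "\<dots> = (\<Sum>l\<in>set ls. \<Sum>A\<in>M. ?c l A)"
    by (rule sum.swap)
  also have "\<dots> \<le> (\<Sum>l\<in>set ls. q ^ (n * n))"
  proof (rule sum_mono)
    fix l assume "l \<in> set ls"
    then have "set (l # ls) \<subseteq> carrier K"
      using assms by auto
    then show "(\<Sum>A\<in>M. ?c l A) \<le> q ^ (n * n)"
      using sum_card_indep_eigvec_lists[of "l # ls"] prod_power_diff_le[of "length (l # ls)"] by simp
  qed
  also have "\<dots> = length ls * q ^ (n * n)"
    using assms by (simp add: distinct_card)
  finally show ?thesis
    by simp
qed

text \<open>Inclusion-exclusion, cut off at \<open>n\<close> because no operator has more
  eigenvalues. The number of terms is thus independent of \<open>q\<close>.\<close>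

lemma card_spectrum_free:
  "real (card {A \<in> M. eigvals A = {}}) =
    (\<Sum>j\<le>n. (-1) ^ j * (\<Sum>L\<in>{L. L \<subseteq> carrier K \<and> card L = j}. real (eigvals_count L)))"
proof -
  let ?P = "{L. L \<subseteq> carrier K \<and> card L \<le> n}"
  have fin: "finite ?P"
    using finite_K by simp
  have "real (card {A \<in> M. eigvals A = {}}) = (\<Sum>A\<in>M. if eigvals A = {} then 1 else 0)"
    using finite_M by (simp add: sum.If_cases Int_def)
  also have "\<dots> = (\<Sum>A\<in>M. \<Sum>L\<in>Pow (eigvals A). (-1) ^ card L)"
    by (simp add: sum_alternating_Pow finite_eigvals)
  also have "\<dots> = (\<Sum>A\<in>M. \<Sum>L\<in>{L. L \<in> ?P \<and> L \<subseteq> eigvals A}. (-1) ^ card L)"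
  proof (intro sum.cong refl)
    fix A assume "A \<in> M"
    show "Pow (eigvals A) = {L. L \<in> ?P \<and> L \<subseteq> eigvals A}"
      using card_eigvals_le[OF \<open>A \<in> M\<close>] finite_eigvals[of A]
      by (auto simp: eigvals_def intro: card_mono order.trans)
  qed
  also have "\<dots> = (\<Sum>L\<in>?P. \<Sum>A\<in>{A. A \<in> M \<and> L \<subseteq> eigvals A}. (-1) ^ card L)"
    by (rule sum.swap_restrict[OF finite_M fin])
  also have "\<dots> = (\<Sum>L\<in>?P. (-1) ^ card L * real (eigvals_count L))"
    by (simp add: eigvals_count_def mult.commute)
  also have "\<dots> = (\<Sum>j\<le>n. \<Sum>L\<in>{L \<in> ?P. card L = j}. (-1) ^ card L * real (eigvals_count L))"
    by (rule sum.group[symmetric]) (use fin in auto)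
  also have "\<dots> = (\<Sum>j\<le>n. (-1) ^ j * (\<Sum>L\<in>{L. L \<subseteq> carrier K \<and> card L = j}. real (eigvals_count L)))"
  proof (intro sum.cong refl)
    fix j assume "j \<in> {..n}"
    then have "{L \<in> ?P. card L = j} = {L. L \<subseteq> carrier K \<and> card L = j}"
      by auto
    then show "(\<Sum>L\<in>{L \<in> ?P. card L = j}. (-1) ^ card L * real (eigvals_count L)) =
        (-1) ^ j * (\<Sum>L\<in>{L. L \<subseteq> carrier K \<and> card L = j}. real (eigvals_count L))"
      by (simp add: sum_distrib_left)
  qed
  finally show ?thesis .
qed

text \<open>The hypothesis \<open>j \<le> n\<close> makes the truncated subtractions genuine; each
  factor then gives up \<open>q ^ n\<close>.\<close>

lemma real_prod_power_diff:
  assumes "j \<le> n"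
  shows "real ((\<Prod>i<j. q ^ n - q ^ i) * q ^ (n * (n - j))) =
    (\<Prod>i<j. 1 - real q ^ i / real q ^ n) * real q ^ (n * n)"
proof -
  have q: "real q > 0"
    using q_gt_1 by simp
  have "real (\<Prod>i<j. q ^ n - q ^ i) = (\<Prod>i<j. real q ^ n * (1 - real q ^ i / real q ^ n))"
    unfolding of_nat_prod
  proof (intro prod.cong refl)
    fix i assume "i \<in> {..<j}"
    then have "q ^ i \<le> q ^ n"
      using assms q_gt_1 by (intro power_increasing) auto
    then show "real (q ^ n - q ^ i) = real q ^ n * (1 - real q ^ i / real q ^ n)"
      using q by (simp add: of_nat_diff field_simps)
  qed
  also have "\<dots> = real q ^ (n * j) * (\<Prod>i<j. 1 - real q ^ i / real q ^ n)"
    by (simp add: prod.distrib power_mult)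
  finally have "real ((\<Prod>i<j. q ^ n - q ^ i) * q ^ (n * (n - j))) =
      (\<Prod>i<j. 1 - real q ^ i / real q ^ n) * real q ^ (n * j + n * (n - j))"
    by (simp add: power_add)
  also have "n * j + n * (n - j) = n * n"
    using assms by (simp flip: distrib_left)
  finally show ?thesis .
qed

text \<open>The bounds depend on \<open>L\<close> only through its size. The correction
  \<open>j / (q - 1)\<close> is the price of large eigenspaces.\<close>

lemma eigvals_count_bounds:
  assumes "L \<subseteq> carrier K" "card L = j" "j \<le> n"
  shows "real (eigvals_count L) / real q ^ (n * n) \<le> 1 / (real q - 1) ^ j"
    and "((\<Prod>i<j. 1 - real q ^ i / real q ^ n) - j / (real q - 1)) / (real q - 1) ^ j
      \<le> real (eigvals_count L) / real q ^ (n * n)"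
proof -
  have "finite L"
    using assms finite_K finite_subset by blast
  then obtain ls where ls: "set ls = L" "distinct ls"
    using finite_distinct_list by blast
  then have len: "length ls = j"
    using assms(2) distinct_card by metis
  have q1: "real (q - 1) = real q - 1" "real q - 1 > 0"
    using q_gt_1 by (auto simp: of_nat_diff simp del: One_nat_def)
  let ?Q = "real q ^ (n * n)" and ?e = "real (eigvals_count L)"
    and ?p = "\<Prod>i<j. 1 - real q ^ i / real q ^ n"
  have Q: "?Q > 0"
    using q_gt_1 by simp
  have "(q - 1) ^ j * eigvals_count L \<le> q ^ (n * n)"
    using eigvals_count_upper[OF ls(2)] prod_power_diff_le[of j] assms ls len by fastforce
  then have "real ((q - 1) ^ j * eigvals_count L) \<le> real (q ^ (n * n))"
    by (rule of_nat_mono)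
  then have "(real q - 1) ^ j * ?e \<le> ?Q"
    by (simp add: q1 del: One_nat_def)
  with q1 Q show "?e / ?Q \<le> 1 / (real q - 1) ^ j"
    by (simp add: field_simps)
  have "(q - 1) * ((\<Prod>i<j. q ^ n - q ^ i) * q ^ (n * (n - j))) \<le>
      (q - 1) ^ Suc j * eigvals_count L + j * q ^ (n * n)"
    using eigvals_count_lower[OF ls(2)] assms ls len by metis
  then have "real ((q - 1) * ((\<Prod>i<j. q ^ n - q ^ i) * q ^ (n * (n - j)))) \<le>
      real ((q - 1) ^ Suc j * eigvals_count L + j * q ^ (n * n))"
    by (rule of_nat_mono)
  then have "(real q - 1) * (?p * ?Q) \<le> (real q - 1) ^ Suc j * ?e + real j * ?Q"
    unfolding of_nat_mult[of "q - 1"] real_prod_power_diff[OF assms(3)] by (simp add: q1 del: One_nat_def)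
  then have "(?p - j / (real q - 1)) * ?Q \<le> (real q - 1) ^ j * ?e"
    using q1 by (simp add: field_simps)
  then show "(?p - j / (real q - 1)) / (real q - 1) ^ j \<le> ?e / ?Q"
    using q1 Q by (simp add: pos_divide_le_eq pos_le_divide_eq mult_ac)
qed

lemma sum_eigvals_count_bounds:
  assumes "j \<le> n"
  defines "S \<equiv> (\<Sum>L\<in>{L. L \<subseteq> carrier K \<and> card L = j}. real (eigvals_count L)) / real q ^ (n * n)"
  shows "S \<le> real (q choose j) / (real q - 1) ^ j"
    and "real (q choose j) / (real q - 1) ^ j * ((\<Prod>i<j. 1 - real q ^ i / real q ^ n) - j / (real q - 1)) \<le> S"
proof -
  let ?P = "{L. L \<subseteq> carrier K \<and> card L = j}"
  have S: "S = (\<Sum>L\<in>?P. real (eigvals_count L) / real q ^ (n * n))"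
    by (simp add: S_def sum_divide_distrib)
  have card: "card ?P = q choose j"
    using finite_K by (rule n_subsets)
  have "S \<le> real (card ?P) * (1 / (real q - 1) ^ j)"
    unfolding S using eigvals_count_bounds(1)[OF _ _ assms(1)] by (intro sum_bounded_above) auto
  then show "S \<le> real (q choose j) / (real q - 1) ^ j"
    by (simp add: card)
  have "real (card ?P) * (((\<Prod>i<j. 1 - real q ^ i / real q ^ n) - j / (real q - 1)) / (real q - 1) ^ j) \<le> S"
    unfolding S using eigvals_count_bounds(2)[OF _ _ assms(1)] by (intro sum_bounded_below) auto
  then show "real (q choose j) / (real q - 1) ^ j * ((\<Prod>i<j. 1 - real q ^ i / real q ^ n) - j / (real q - 1)) \<le> S"
    by (simp add: card mult_ac)
qed

end

section \<open>Matrices over a finite field\<close>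

locale finite_field = field F for F :: "'a ring" (structure) +
  assumes finite_carrier: "finite (carrier F)"
begin

lemma card_coord_space:
  "card (carrier (coord_space F n)) = card (carrier F) ^ n"
proof -
  have "bij_betw (\<lambda>v. restrict (\<lambda>i. v $ i) {..<n}) (carrier (coord_space F n)) ({..<n} \<rightarrow>\<^sub>E carrier F)"
    by (rule bij_betwI[where g = "vec n"])
      (auto simp: coord_space_def PiE_iff extensional_def fun_eq_iff intro!: eq_vecI)
  then show ?thesis
    using finite_carrier by (simp add: bij_betw_same_card card_funcsetE)
qed

lemma finite_coord_space:
  "finite (carrier (coord_space F n))"
proof -
  have "carrier F \<noteq> {}" by auto
  then show ?thesis
    using card_coord_space[of n] finite_carrier card_ge_0_finite by (fastforce simp: card_gt_0_iff)
qed

lemma card_matrix_space: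
  "card (carrier (matrix_space F m n)) = card (carrier F) ^ (m * n)"
proof -
  let ?I = "{..<m} \<times> {..<n}"
  have "bij_betw (\<lambda>A. restrict (\<lambda>ij. A $$ ij) ?I) (carrier (matrix_space F m n)) (?I \<rightarrow>\<^sub>E carrier F)"
    by (rule bij_betwI[where g = "mat m n"])
      (auto simp: matrix_space_def PiE_iff extensional_def fun_eq_iff intro!: eq_matI)
  then show ?thesis
    using finite_carrier by (simp add: bij_betw_same_card card_funcsetE card_cartesian_product)
qed

lemma finite_matrix_space:
  "finite (carrier (matrix_space F m n))"
proof -
  have "carrier F \<noteq> {}" by auto
  then show ?thesis
    using card_matrix_space[of m n] finite_carrier by (fastforce simp: card_gt_0_iff)
qed

lemma finite_vectorspace_coord_space:
  "finite_vectorspace F (coord_space F n)"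
  by (intro finite_vectorspace.intro vectorspace_coord_space finite_vectorspace_axioms.intro
      finite_coord_space finite_carrier field_axioms)

lemma finite_vectorspace_matrix_space:
  "finite_vectorspace F (matrix_space F m n)"
  by (intro finite_vectorspace.intro vectorspace_matrix_space finite_vectorspace_axioms.intro
      finite_matrix_space finite_carrier field_axioms)

lemma mat_vec_prod_hom:
  assumes "A \<in> carrier (matrix_space F m m)"
  shows "mat_vec_prod F A \<in> module_hom F (coord_space F m) (coord_space F m)"
proof -
  have A: "dim_row A = m" "dim_col A = m" "\<And>i j. i < m \<Longrightarrow> j < m \<Longrightarrow> A $$ (i, j) \<in> carrier F"
    using assms by (auto simp: matrix_space_def)
  have "(\<Oplus>j\<in>{..<m}. A $$ (i, j) \<otimes> vec m (\<lambda>j. a \<otimes> v $ j) $ j) =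
      a \<otimes> (\<Oplus>j\<in>{..<m}. A $$ (i, j) \<otimes> v $ j)"
    if "i < m" "a \<in> carrier F" "v \<in> carrier (coord_space F m)" for i a v
  proof -
    have "(\<Oplus>j\<in>{..<m}. A $$ (i, j) \<otimes> vec m (\<lambda>j. a \<otimes> v $ j) $ j) =
        (\<Oplus>j\<in>{..<m}. a \<otimes> (A $$ (i, j) \<otimes> v $ j))"
      using that A by (intro finsum_cong') (auto simp: coord_space_def m_lcomm)
    then show ?thesis
      using that A by (subst finsum_rdistr) (auto simp: coord_space_def)
  qed
  moreover have "(\<Oplus>j\<in>{..<m}. A $$ (i, j) \<otimes> vec m (\<lambda>j. v $ j \<oplus> w $ j) $ j) =
      (\<Oplus>j\<in>{..<m}. A $$ (i, j) \<otimes> v $ j) \<oplus> (\<Oplus>j\<in>{..<m}. A $$ (i, j) \<otimes> w $ j)"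
    if "i < m" "v \<in> carrier (coord_space F m)" "w \<in> carrier (coord_space F m)" for i v w
  proof -
    have "(\<Oplus>j\<in>{..<m}. A $$ (i, j) \<otimes> vec m (\<lambda>j. v $ j \<oplus> w $ j) $ j) =
        (\<Oplus>j\<in>{..<m}. A $$ (i, j) \<otimes> v $ j \<oplus> A $$ (i, j) \<otimes> w $ j)"
      using that A by (intro finsum_cong') (auto simp: coord_space_def r_distr)
    also have "\<dots> = (\<Oplus>j\<in>{..<m}. A $$ (i, j) \<otimes> v $ j) \<oplus> (\<Oplus>j\<in>{..<m}. A $$ (i, j) \<otimes> w $ j)"
      using that A by (intro finsum_addf) (auto simp: coord_space_def)
    finally show ?thesis .
  qed
  moreover have "(\<Oplus>j\<in>{..<m}. A $$ (i, j) \<otimes> v $ j) \<in> carrier F"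
    if "i < m" "v \<in> carrier (coord_space F m)" for i v
    using that A by (intro finsum_closed) (auto simp: coord_space_def)
  ultimately show ?thesis
    using A by (auto simp: module_hom_def mat_vec_prod_def coord_space_def intro!: eq_vecI)
qed

text \<open>Unit vectors recover the columns of a matrix, which gives faithfulness of the
  action.\<close>

lemma mat_vec_prod_unit:
  assumes "A \<in> carrier (matrix_space F m m)" "i < m" "k < m"
  shows "mat_vec_prod F A (vec m (\<lambda>j. if k = j then \<one> else \<zero>)) $ i = A $$ (i, k)"
proof -
  have A: "dim_row A = m" "dim_col A = m" "\<And>i j. i < m \<Longrightarrow> j < m \<Longrightarrow> A $$ (i, j) \<in> carrier F"
    using assms by (auto simp: matrix_space_def)
  have "mat_vec_prod F A (vec m (\<lambda>j. if k = j then \<one> else \<zero>)) $ i =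
      (\<Oplus>j\<in>{..<m}. A $$ (i, j) \<otimes> (if k = j then \<one> else \<zero>))"
    using assms A by (auto simp: mat_vec_prod_def intro!: finsum_cong')
  also have "\<dots> = (\<Oplus>j\<in>{..<m}. if k = j then A $$ (i, j) else \<zero>)"
    using assms A by (intro finsum_cong') auto
  also have "\<dots> = A $$ (i, k)"
    using assms A by (intro add.finprod_singleton[of k "{..<m}" "\<lambda>j. A $$ (i, j)"]) auto
  finally show ?thesis .
qed

lemma full_operator_family_matrices:
  "full_operator_family F (coord_space F m) (carrier (matrix_space F m m)) (mat_vec_prod F) m"
proof (intro full_operator_family.intro full_operator_family_axioms.intro)
  show "finite_vectorspace F (coord_space F m)"
    by (rule finite_vectorspace_coord_space)
  fix A B
  assume A: "A \<in> carrier (matrix_space F m m)" and B: "B \<in> carrier (matrix_space F m m)"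
    and eq: "\<And>v. v \<in> carrier (coord_space F m) \<Longrightarrow> mat_vec_prod F A v = mat_vec_prod F B v"
  have "A $$ (i, k) = B $$ (i, k)" if "i < m" "k < m" for i k
  proof -
    have "vec m (\<lambda>j. if k = j then \<one> else \<zero>) \<in> carrier (coord_space F m)"
      by (auto simp: coord_space_def)
    then show ?thesis
      using mat_vec_prod_unit[OF A that] mat_vec_prod_unit[OF B that] eq by metis
  qed
  with A B show "A = B"
    by (auto simp: matrix_space_def intro!: eq_matI)
qed (use finite_carrier in \<open>auto simp: mat_vec_prod_hom card_coord_space card_matrix_space finite_matrix_space\<close>)

end

section \<open>MRD codes as graphs of matrices without eigenvalues\<close>

context finite_field
begin

abbreviation q :: nat where "q \<equiv> card (carrier F)"

definition two_col :: "nat \<Rightarrow> 'a vec \<Rightarrow> 'a vec \<Rightarrow> 'a mat" where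
  "two_col m x y = mat m 2 (\<lambda>(i, j). if j = 0 then x $ i else y $ i)"

lemma two_col_closed:
  "x \<in> carrier (coord_space F m) \<Longrightarrow> y \<in> carrier (coord_space F m) \<Longrightarrow>
    two_col m x y \<in> carrier (matrix_space F m 2)"
  by (auto simp: two_col_def coord_space_def matrix_space_def)

lemma col_two_col:
  assumes "x \<in> carrier (coord_space F m)" "y \<in> carrier (coord_space F m)"
  shows "col (two_col m x y) 0 = x" "col (two_col m x y) 1 = y"
  using assms by (auto simp: two_col_def coord_space_def)

lemma cols_two_col:
  assumes "x \<in> carrier (coord_space F m)" "y \<in> carrier (coord_space F m)"
  shows "cols (two_col m x y) = [x, y]"
proof -
  have "cols (two_col m x y) = [col (two_col m x y) 0, col (two_col m x y) 1]"
    by (simp add: cols_def two_col_def numeral_2_eq_2)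
  then show ?thesis
    using assms by (simp only: col_two_col)
qed

lemma two_col_cols:
  assumes "A \<in> carrier (matrix_space F m 2)"
  shows "two_col m (col A 0) (col A 1) = A"
  using assms by (auto simp: two_col_def matrix_space_def less_2_cases_iff intro!: eq_matI)

lemma col_hom:
  assumes "j < n"
  shows "(\<lambda>A. col A j) \<in> module_hom F (matrix_space F m n) (coord_space F m)"
  using assms by (auto simp: module_hom_def matrix_space_def coord_space_def intro!: eq_vecI)

lemma zero_two_col:
  "two_col m \<zero>\<^bsub>coord_space F m\<^esub> \<zero>\<^bsub>coord_space F m\<^esub> = \<zero>\<^bsub>matrix_space F m 2\<^esub>"
  by (auto simp: two_col_def matrix_space_def coord_space_def intro!: eq_matI)

lemma add_two_col:
  "two_col m x y \<oplus>\<^bsub>matrix_space F m 2\<^esub> two_col m x' y' =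
    two_col m (x \<oplus>\<^bsub>coord_space F m\<^esub> x') (y \<oplus>\<^bsub>coord_space F m\<^esub> y')"
  by (auto simp: two_col_def matrix_space_def coord_space_def intro!: eq_matI)

lemma smult_two_col:
  "a \<odot>\<^bsub>matrix_space F m 2\<^esub> two_col m x y =
    two_col m (a \<odot>\<^bsub>coord_space F m\<^esub> x) (a \<odot>\<^bsub>coord_space F m\<^esub> y)"
  by (auto simp: two_col_def matrix_space_def coord_space_def intro!: eq_matI)

text \<open>Rank 2 means that the columns span \<open>q ^ 2\<close> vectors. The resulting condition
  on \<open>y\<close> is shaped like the negated eigenvalue equation.\<close>

lemma mat_rank_two_col:
  assumes "x \<in> carrier (coord_space F m)" "y \<in> carrier (coord_space F m)"
  shows "mat_rank F (two_col m x y) = 2 \<longleftrightarrow>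
    x \<noteq> \<zero>\<^bsub>coord_space F m\<^esub> \<and> (\<forall>l\<in>carrier F. y \<noteq> l \<odot>\<^bsub>coord_space F m\<^esub> x)"
proof -
  interpret V: finite_vectorspace F "coord_space F m"
    by (rule finite_vectorspace_coord_space)
  have "mat_rank F (two_col m x y) = 2 \<longleftrightarrow> card (V.span {y, x}) = q ^ 2"
    using assms V.dim_submodule_iff[OF V.span_is_submodule, of "{y, x}"]
    by (simp add: mat_rank_def Let_def cols_two_col insert_commute) (simp add: two_col_def)
  also have "\<dots> \<longleftrightarrow> x \<noteq> \<zero>\<^bsub>coord_space F m\<^esub> \<and> y \<notin> V.span {x}"
  proof (cases "y \<in> V.span {x}")
    case True
    then have "V.span {y, x} = V.span {x}"
      using assms V.already_in_span[of "{x}" y] by simp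
    then have "card (V.span {y, x}) \<le> q"
      using assms finite_carrier by (simp add: V.span_singleton card_image_le)
    also have "q < q ^ 2"
      using V.q_gt_1 by (simp add: power2_eq_square)
    finally show ?thesis
      using True by simp
  next
    case y: False
    show ?thesis
    proof (cases "x = \<zero>\<^bsub>coord_space F m\<^esub>")
      case True
      then have "V.span {x} = {\<zero>\<^bsub>coord_space F m\<^esub>}"
        using assms by (auto simp: V.span_singleton)
      then have "card (V.span {y, x}) = q"
        using assms y V.card_span_insert[of y "{x}"] by simp
      with True show ?thesis
        using V.q_gt_1 by (simp add: power2_eq_square)
    next
      case False
      then have "V.indep [y, x]"
        using assms y by (simp add: V.span_empty)
      from V.card_span_indep[OF this] show ?thesis
        using y False by (simp add: power2_eq_square)
    qed
  qed
  finally show ?thesis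
    using assms by (auto simp: V.span_singleton)
qed

definition graph_code :: "nat \<Rightarrow> 'a mat \<Rightarrow> 'a mat set" where
  "graph_code m B = (\<lambda>x. two_col m x (mat_vec_prod F B x)) ` carrier (coord_space F m)"

lemma rank_metric_codes_iff:
  "C \<in> rank_metric_codes F m n k \<longleftrightarrow> submodule F C (matrix_space F m n) \<and> card C = q ^ k"
proof -
  interpret W: finite_vectorspace F "matrix_space F m n"
    by (rule finite_vectorspace_matrix_space)
  show ?thesis
    using W.dim_submodule_iff W.vectorspace_axioms by (auto simp: rank_metric_codes_def subspace_def)
qed

lemma mat_vec_prod_closed:
  "B \<in> carrier (matrix_space F m m) \<Longrightarrow> x \<in> carrier (coord_space F m) \<Longrightarrow>
    mat_vec_prod F B x \<in> carrier (coord_space F m)"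
  using mat_vec_prod_hom[of B m] by (auto simp: module_hom_def)

lemma eigenvalues_eq:
  assumes "B \<in> carrier (matrix_space F m m)"
  shows "eigenvalues F B =
    full_operator_family.eigvals F (coord_space F m) (mat_vec_prod F) B"
proof -
  interpret V: full_operator_family F "coord_space F m" "carrier (matrix_space F m m)" "mat_vec_prod F" m
    by (rule full_operator_family_matrices)
  have "dim_row B = m"
    using assms by (auto simp: matrix_space_def)
  then show ?thesis
    by (auto simp: eigenvalues_def Let_def V.eigvals_def V.eigvecs_def)
qed

lemma inj_on_graph_code: "inj_on (graph_code m) (carrier (matrix_space F m m))"
proof (rule inj_onI)
  interpret V: full_operator_family F "coord_space F m" "carrier (matrix_space F m m)" "mat_vec_prod F" m
    by (rule full_operator_family_matrices)
  fix A B assume AB: "A \<in> carrier (matrix_space F m m)" "B \<in> carrier (matrix_space F m m)"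
    and eq: "graph_code m A = graph_code m B"
  show "A = B"
  proof (rule V.act_faithful[OF AB])
    fix x assume x: "x \<in> carrier (coord_space F m)"
    then have "two_col m x (mat_vec_prod F A x) \<in> graph_code m A"
      by (simp add: graph_code_def)
    then obtain y where y: "y \<in> carrier (coord_space F m)"
      "two_col m x (mat_vec_prod F A x) = two_col m y (mat_vec_prod F B y)"
      unfolding eq by (auto simp: graph_code_def)
    then have "[x, mat_vec_prod F A x] = [y, mat_vec_prod F B y]"
      using x AB by (metis cols_two_col mat_vec_prod_closed)
    then show "mat_vec_prod F A x = mat_vec_prod F B x"
      by auto
  qed
qed

lemma graph_code_in_rank_metric_codes:
  assumes B: "B \<in> carrier (matrix_space F m m)"
  shows "graph_code m B \<in> rank_metric_codes F m 2 m"
  unfolding rank_metric_codes_iff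
proof
  interpret V: vectorspace F "coord_space F m"
    by (rule vectorspace_coord_space) (rule field_axioms)
  interpret W: vectorspace F "matrix_space F m 2"
    by (rule vectorspace_matrix_space) (rule field_axioms)
  interpret mod_hom F "coord_space F m" "coord_space F m" "mat_vec_prod F B"
    by unfold_locales (rule mat_vec_prod_hom[OF B])
  show "submodule F (graph_code m B) (matrix_space F m 2)"
  proof (rule submodule.intro)
    show "module F (matrix_space F m 2)"
      by (rule W.module_axioms)
    show "graph_code m B \<subseteq> carrier (matrix_space F m 2)"
      using B by (auto simp: graph_code_def two_col_closed mat_vec_prod_closed)
    show "\<zero>\<^bsub>matrix_space F m 2\<^esub> \<in> graph_code m B"
      unfolding graph_code_def by (rule image_eqI[of _ _ "\<zero>\<^bsub>coord_space F m\<^esub>"]) (auto simp: zero_two_col)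
    show "v \<oplus>\<^bsub>matrix_space F m 2\<^esub> w \<in> graph_code m B" if "v \<in> graph_code m B" "w \<in> graph_code m B" for v w
      using that by (auto simp: graph_code_def add_two_col simp flip: f_add)
    show "c \<odot>\<^bsub>matrix_space F m 2\<^esub> v \<in> graph_code m B" if "c \<in> carrier F" "v \<in> graph_code m B" for c v
      using that by (auto simp: graph_code_def smult_two_col simp flip: f_smult)
  qed
  have "inj_on (\<lambda>x. two_col m x (mat_vec_prod F B x)) (carrier (coord_space F m))"
    by (rule inj_onI) (metis B col_two_col(1) mat_vec_prod_closed)
  then show "card (graph_code m B) = q ^ m"
    by (simp add: graph_code_def card_image card_coord_space)
qed

text \<open>The nonzero codewords are those with first column \<open>x\<close> nonzero; such a word
  loses rank exactly when its second column \<open>B x\<close> is a multiple of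
  \<open>x\<close>.\<close>

lemma graph_code_mrd_iff:
  assumes B: "B \<in> carrier (matrix_space F m m)"
  shows "graph_code m B \<in> mrd_codes F m \<longleftrightarrow> eigenvalues F B = {}"
proof -
  interpret V: full_operator_family F "coord_space F m" "carrier (matrix_space F m m)" "mat_vec_prod F" m
    by (rule full_operator_family_matrices)
  have zero: "two_col m x (mat_vec_prod F B x) = \<zero>\<^bsub>matrix_space F m 2\<^esub> \<longleftrightarrow> x = \<zero>\<^bsub>coord_space F m\<^esub>"
    if "x \<in> carrier (coord_space F m)" for x
  proof
    assume "two_col m x (mat_vec_prod F B x) = \<zero>\<^bsub>matrix_space F m 2\<^esub>"
    then show "x = \<zero>\<^bsub>coord_space F m\<^esub>"
      using col_two_col(1)[OF that mat_vec_prod_closed[OF B that]]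
        col_two_col(1)[OF V.M.zero_closed V.M.zero_closed] by (simp add: zero_two_col)
  qed (use V.act_zero[OF B] in \<open>simp add: zero_two_col\<close>)
  have "graph_code m B \<in> mrd_codes F m \<longleftrightarrow>
      (\<forall>x\<in>carrier (coord_space F m). x \<noteq> \<zero>\<^bsub>coord_space F m\<^esub> \<longrightarrow>
        (\<forall>l\<in>carrier F. mat_vec_prod F B x \<noteq> l \<odot>\<^bsub>coord_space F m\<^esub> x))"
    using graph_code_in_rank_metric_codes[OF B]
    by (auto simp: mrd_codes_def graph_code_def zero mat_rank_two_col mat_vec_prod_closed[OF B])
  also have "\<dots> \<longleftrightarrow> eigenvalues F B = {}"
    by (auto simp: eigenvalues_eq[OF B] V.eigvals_def V.eigvecs_def)
  finally show ?thesis .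
qed

text \<open>Two codewords with equal first columns differ by a codeword with zero first column,
  whose rank is not 2. So the first column is injective on \<open>C\<close>, and the second column
  is a linear function of it.\<close>

lemma mrd_code_is_graph_code:
  assumes C: "C \<in> mrd_codes F m"
  obtains B where "B \<in> carrier (matrix_space F m m)" "C = graph_code m B"
proof -
  let ?V = "coord_space F m" and ?W = "matrix_space F m 2"
  interpret V: full_operator_family F ?V "carrier (matrix_space F m m)" "mat_vec_prod F" m
    by (rule full_operator_family_matrices)
  interpret W: finite_vectorspace F ?W
    by (rule finite_vectorspace_matrix_space)
  interpret p0: mod_hom F ?W ?V "\<lambda>A. col A 0"
    by unfold_locales (simp add: col_hom)
  interpret p1: mod_hom F ?W ?V "\<lambda>A. col A 1"
    by unfold_locales (simp add: col_hom)
  have sub: "submodule F C ?W" and card: "card C = q ^ m"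
    and rank: "\<And>A. A \<in> C \<Longrightarrow> A \<noteq> \<zero>\<^bsub>?W\<^esub> \<Longrightarrow> mat_rank F A = 2"
    using C by (auto simp: mrd_codes_def rank_metric_codes_iff)
  interpret C: submodule F C ?W by fact
  have CW: "A \<in> carrier ?W" if "A \<in> C" for A
    using that C.subset by blast
  have inj: "inj_on (\<lambda>A. col A 0) C"
  proof (rule inj_onI)
    fix A A' assume A: "A \<in> C" "A' \<in> C" "col A 0 = col A' 0"
    let ?D = "A \<ominus>\<^bsub>?W\<^esub> A'"
    have D: "?D \<in> C"
      using A by (intro W.submodule_diff_closed[OF sub])
    have "col ?D 0 = \<zero>\<^bsub>?V\<^esub>"
      using A CW by (simp add: V.M.r_neg a_minus_def)
    then have "mat_rank F (two_col m (col ?D 0) (col ?D 1)) \<noteq> 2"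
      using p0.f_im[OF CW[OF D]] p1.f_im[OF CW[OF D]] by (simp add: mat_rank_two_col)
    then have "?D = \<zero>\<^bsub>?W\<^esub>"
      using rank[OF D] unfolding two_col_cols[OF CW[OF D]] by blast
    then show "A = A'"
      using A CW by simp
  qed
  \<comment> \<open>Here the dimension of the code enters: an injective map between sets of
    \<open>q ^ m\<close> elements is onto.\<close>
  have img: "(\<lambda>A. col A 0) ` C = carrier ?V"
    using inj CW by (intro card_subset_eq finite_coord_space) (auto simp: card_image card card_coord_space)
  define s where "s = the_inv_into C (\<lambda>A. col A 0)"
  have s: "s x \<in> C" "col (s x) 0 = x" if "x \<in> carrier ?V" for x
    using that img inj unfolding s_def by (auto intro: the_inv_into_into f_the_inv_into_f)
  have s_eq: "s (col A 0) = A" if "A \<in> C" for A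
    unfolding s_def using inj that by (rule the_inv_into_f_f)
  have "(\<lambda>x. col (s x) 1) \<in> module_hom F ?V ?V"
  proof -
    \<comment> \<open>Both sides are the unique codeword with the given first column; the same
      reason gives homogeneity.\<close>
    have "s (x \<oplus>\<^bsub>?V\<^esub> y) = s x \<oplus>\<^bsub>?W\<^esub> s y" if "x \<in> carrier ?V" "y \<in> carrier ?V" for x y
      using that s s_eq[of "s x \<oplus>\<^bsub>?W\<^esub> s y"] CW by simp
    moreover have "s (a \<odot>\<^bsub>?V\<^esub> x) = a \<odot>\<^bsub>?W\<^esub> s x" if "a \<in> carrier F" "x \<in> carrier ?V" for a x
      using that s s_eq[of "a \<odot>\<^bsub>?W\<^esub> s x"] CW by simp
    ultimately show ?thesis
      using s CW p1.f_im p1.f_add p1.f_smult by (auto simp: module_hom_def)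
  qed
  then obtain B where B: "B \<in> carrier (matrix_space F m m)"
    "\<And>x. x \<in> carrier ?V \<Longrightarrow> mat_vec_prod F B x = col (s x) 1"
    using V.hom_represented by blast
  have "two_col m x (mat_vec_prod F B x) = s x" if "x \<in> carrier ?V" for x
    using two_col_cols[OF CW[OF s(1)[OF that]]] s(2)[OF that] B(2)[OF that] by simp
  then have "graph_code m B = s ` carrier ?V"
    by (simp add: graph_code_def)
  also have "\<dots> = C"
    unfolding img[symmetric] using s_eq by (simp add: image_image)
  finally show ?thesis
    using that B by blast
qed

section \<open>Counting codes and the formula for the proportion\<close>

lemma card_mrd_codes: "card (mrd_codes F m) = spectrum_free_count F m"
proof -
  have "mrd_codes F m = graph_code m ` {A \<in> carrier (matrix_space F m m). eigenvalues F A = {}}"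
    using graph_code_mrd_iff mrd_code_is_graph_code by (auto simp: image_iff) metis
  moreover have "inj_on (graph_code m) {A \<in> carrier (matrix_space F m m). eigenvalues F A = {}}"
    using inj_on_graph_code by (rule inj_on_subset) auto
  ultimately show ?thesis
    by (simp add: spectrum_free_count_def card_image)
qed

lemma card_rank_metric_codes:
  "card (rank_metric_codes F m 2 k) * (\<Prod>i<k. q ^ k - q ^ i) = (\<Prod>i<k. q ^ (2 * m) - q ^ i)"
proof -
  interpret W: finite_vectorspace F "matrix_space F m 2"
    by (rule finite_vectorspace_matrix_space)
  have "rank_metric_codes F m 2 k = {C. submodule F C (matrix_space F m 2) \<and> card C = q ^ k}"
    using rank_metric_codes_iff by blast
  then show ?thesis
    using W.card_subspaces[of "2 * m" k] by (simp add: card_matrix_space mult.commute)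
qed

text \<open>The last quotient is \<open>q ^ (m\<^sup>2)\<close> divided by the number of codes, so
  the power of \<open>q\<close> cancels.\<close>

lemma mrd_proportion_eq:
  "mrd_proportion F m = real (spectrum_free_count F m) / real q ^ (m\<^sup>2) *
    ((\<Prod>i<m. real q ^ (2 * m) - real q ^ (i + m)) / (\<Prod>i<m. real q ^ (2 * m) - real q ^ i))"
proof -
  interpret V: finite_vectorspace F "coord_space F m"
    by (rule finite_vectorspace_coord_space)
  have q: "q > 1"
    by (rule V.q_gt_1)
  have *: "real (\<Prod>i<m. q ^ n - q ^ i) = (\<Prod>i<m. real q ^ n - real q ^ i)" if "m \<le> n" for n
    unfolding of_nat_prod
    by (intro prod.cong refl) (use that q in \<open>auto simp: of_nat_diff intro!: power_increasing\<close>)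
  \<comment> \<open>The number of ordered bases of an \<open>m\<close>-dimensional space, a common
    factor of both products.\<close>
  let ?P = "\<Prod>i<m. real q ^ m - real q ^ i"
  have "?P > 0"
    using q by (intro prod_pos) auto
  moreover have P2: "real (card (rank_metric_codes F m 2 m)) * ?P = (\<Prod>i<m. real q ^ (2 * m) - real q ^ i)"
    using arg_cong[OF card_rank_metric_codes[of m m], of real] *[of m] *[of "2 * m"] by simp
  moreover have P1: "(\<Prod>i<m. real q ^ (2 * m) - real q ^ (i + m)) = real q ^ (m\<^sup>2) * ?P"
  proof -
    have "real q ^ (2 * m) = real q ^ m * real q ^ m"
      by (simp add: mult_2 power_add)
    then have "(\<Prod>i<m. real q ^ (2 * m) - real q ^ (i + m)) = (\<Prod>i<m. real q ^ m * (real q ^ m - real q ^ i))"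
      by (intro prod.cong refl) (simp add: power_add algebra_simps)
    then show ?thesis
      by (simp add: prod.distrib power_mult power2_eq_square)
  qed
  ultimately show ?thesis
    using q by (simp add: mrd_proportion_def card_mrd_codes flip: P2)
qed

text \<open>Hides the field behind \<open>S\<close>: the bounds mention only \<open>q\<close>,
  \<open>m\<close> and \<open>j\<close>, so a sandwich argument works for any choice of
  fields.\<close>

lemma spectrum_free_proportion_bounds:
  obtains S where
    "real (spectrum_free_count F m) / real q ^ (m\<^sup>2) = (\<Sum>j\<le>m. (-1) ^ j * S j)"
    "\<And>j. j \<le> m \<Longrightarrow> S j \<le> real (q choose j) / (real q - 1) ^ j"
    "\<And>j. j \<le> m \<Longrightarrow> real (q choose j) / (real q - 1) ^ j *
      ((\<Prod>i<j. 1 - real q ^ i / real q ^ m) - j / (real q - 1)) \<le> S j"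
proof -
  interpret V: full_operator_family F "coord_space F m" "carrier (matrix_space F m m)" "mat_vec_prod F" m
    by (rule full_operator_family_matrices)
  have eq: "spectrum_free_count F m = card {A \<in> carrier (matrix_space F m m). V.eigvals A = {}}"
    unfolding spectrum_free_count_def by (rule arg_cong[where f = card]) (auto simp: eigenvalues_eq)
  show ?thesis
  proof (rule that)
    show "real (spectrum_free_count F m) / real q ^ (m\<^sup>2) = (\<Sum>j\<le>m. (-1) ^ j *
        ((\<Sum>L\<in>{L. L \<subseteq> carrier F \<and> card L = j}. real (V.eigvals_count L)) / real q ^ (m * m)))"
      unfolding eq V.card_spectrum_free sum_divide_distrib[of _ "{..m}"] by (simp add: power2_eq_square)
  qed (use V.sum_eigvals_count_bounds in blast)+
qed

end

section \<open>The limit\<close>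

lemma tendsto_power_quotient_zero:
  assumes "i < k"
  shows "(\<lambda>q. real q ^ i / real q ^ k) \<longlonglongrightarrow> 0"
proof -
  have "(\<lambda>q. (1 / real q) ^ (k - i)) \<longlonglongrightarrow> 0 ^ (k - i)"
    by (intro tendsto_power) real_asymp
  then have "(\<lambda>q. (1 / real q) ^ (k - i)) \<longlonglongrightarrow> 0"
    using assms by (simp only: zero_power zero_less_diff)
  moreover have "\<forall>\<^sub>F q in sequentially. (1 / real q) ^ (k - i) = real q ^ i / real q ^ k"
    using eventually_gt_at_top[of 0]
    by eventually_elim (use assms in \<open>simp add: power_diff field_simps\<close>)
  ultimately show ?thesis
    by (rule Lim_transform_eventually)
qed

lemma tendsto_choose_over_power:
  "(\<lambda>q. real (q choose j) / (real q - 1) ^ j) \<longlonglongrightarrow> 1 / fact j"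
proof -
  have "(\<lambda>q. (\<Prod>i<j. (real q - real i) / (real q - 1)) / fact j) \<longlonglongrightarrow> (\<Prod>i<j. 1) / fact j"
    by (intro tendsto_divide tendsto_const tendsto_prod) (real_asymp | simp)+
  \<comment> \<open>The falling factorial has \<open>j\<close> factors, one for each factor of the
    denominator, and each quotient tends to 1.\<close>
  moreover have "(\<Prod>i<j. (real q - real i) / (real q - 1)) / fact j = real (q choose j) / (real q - 1) ^ j" for q
    by (simp add: binomial_gbinomial gbinomial_prod_rev prod_dividef lessThan_atLeast0)
  ultimately show ?thesis
    by simp
qed

lemma tendsto_prod_one_minus_power_quotient:
  assumes "j \<le> m"
  shows "(\<lambda>q. \<Prod>i<j. 1 - real q ^ i / real q ^ m) \<longlonglongrightarrow> 1"
proof -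
  have "(\<lambda>q. \<Prod>i<j. 1 - real q ^ i / real q ^ m) \<longlonglongrightarrow> (\<Prod>i<j. 1 - 0)"
    using assms by (intro tendsto_prod tendsto_diff tendsto_const tendsto_power_quotient_zero) auto
  then show ?thesis by simp
qed

lemma tendsto_subspace_ratio:
  "(\<lambda>q. (\<Prod>i<m. real q ^ (2 * m) - real q ^ (i + m)) / (\<Prod>i<m. real q ^ (2 * m) - real q ^ i)) \<longlonglongrightarrow> 1"
proof -
  have "(\<lambda>q. (\<Prod>i<m. 1 - real q ^ i / real q ^ m) / (\<Prod>i<m. 1 - real q ^ i / real q ^ (2 * m))) \<longlonglongrightarrow> 1 / 1"
    by (intro tendsto_divide tendsto_prod_one_minus_power_quotient) auto
  moreover have "\<forall>\<^sub>F q in sequentially.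
      (\<Prod>i<m. 1 - real q ^ i / real q ^ m) / (\<Prod>i<m. 1 - real q ^ i / real q ^ (2 * m)) =
      (\<Prod>i<m. real q ^ (2 * m) - real q ^ (i + m)) / (\<Prod>i<m. real q ^ (2 * m) - real q ^ i)"
    using eventually_gt_at_top[of 0]
  proof eventually_elim
    case (elim q)
    \<comment> \<open>Each quotient is reduced by the common factor
      \<open>q ^ (2 * m)\<close>.\<close>
    have "(1 - real q ^ i / real q ^ m) / (1 - real q ^ i / real q ^ (2 * m)) =
        (real q ^ (2 * m) - real q ^ (i + m)) / (real q ^ (2 * m) - real q ^ i)" for i
    proof -
      have "real q ^ (2 * m) - real q ^ (i + m) = real q ^ (2 * m) * (1 - real q ^ i / real q ^ m)"
        "real q ^ (2 * m) - real q ^ i = real q ^ (2 * m) * (1 - real q ^ i / real q ^ (2 * m))"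
        using elim by (simp_all add: right_diff_distrib power_add mult_2)
      with elim show ?thesis by simp
    qed
    then show ?case
      by (simp flip: prod_dividef)
  qed
  ultimately show ?thesis
    using Lim_transform_eventually by force
qed

lemma finite_field_of_order:
  assumes "primepow q" "field K" "order K = q"
  shows "finite_field K" "card (carrier K) = q"
proof -
  show "card (carrier K) = q"
    using assms by (simp add: order_def)
  then have "finite (carrier K)"
    using assms primepow_gt_0_nat card_gt_0_iff by metis
  with assms show "finite_field K"
    by (intro finite_field.intro finite_field_axioms.intro)
qed

text \<open>The filter lets \<open>q\<close> tend to infinity through prime powers only, where
  \<open>F q\<close> is known to be a field of order \<open>q\<close>.\<close>

lemma tendsto_spectrum_free_proportion:
  fixes F :: "nat \<Rightarrow> 'a ring"
  assumes F: "\<And>q. primepow q \<Longrightarrow> field (F q) \<and> order (F q) = q"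
  shows "((\<lambda>q. real (spectrum_free_count (F q) m) / real q ^ (m\<^sup>2)) \<longlongrightarrow> (\<Sum>j\<le>m. (-1) ^ j / fact j))
    (inf at_top (principal {q. primepow q}))" (is "(?p \<longlongrightarrow> _) ?F")
proof -
  let ?u = "\<lambda>j q. real (q choose j) / (real q - 1) ^ j"
  let ?l = "\<lambda>j q. ?u j q * ((\<Prod>i<j. 1 - real q ^ i / real q ^ m) - j / (real q - 1))"
  have "\<exists>S. ?p q = (\<Sum>j\<le>m. (-1) ^ j * S j) \<and> (\<forall>j\<le>m. S j \<le> ?u j q \<and> ?l j q \<le> S j)"
    if q: "primepow q" for q
  proof -
    interpret finite_field "F q"
      using finite_field_of_order(1)[OF q] F[OF q] by blast
    have card: "card (carrier (F q)) = q"
      using finite_field_of_order(2)[OF q] F[OF q] by blast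
    obtain S where "?p q = (\<Sum>j\<le>m. (-1) ^ j * S j)" "\<And>j. j \<le> m \<Longrightarrow> S j \<le> ?u j q"
      "\<And>j. j \<le> m \<Longrightarrow> ?l j q \<le> S j"
      using spectrum_free_proportion_bounds[of m] unfolding card by blast
    then show ?thesis by blast
  qed
  \<comment> \<open>The sums depend on the field, so one family is chosen for all \<open>q\<close>
    at once; only then does convergence for fixed \<open>j\<close> make sense.\<close>
  then have "\<exists>S. \<forall>q. primepow q \<longrightarrow> ?p q = (\<Sum>j\<le>m. (-1) ^ j * S q j) \<and>
      (\<forall>j\<le>m. S q j \<le> ?u j q \<and> ?l j q \<le> S q j)"
    by (intro choice) blast
  then obtain S where S: "\<And>q. primepow q \<Longrightarrow> ?p q = (\<Sum>j\<le>m. (-1) ^ j * S q j)"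
    and bounds: "\<And>q j. primepow q \<Longrightarrow> j \<le> m \<Longrightarrow> S q j \<le> ?u j q \<and> ?l j q \<le> S q j"
    by blast
  have ev: "\<forall>\<^sub>F q in ?F. primepow q"
    by (simp add: eventually_inf_principal)
  have "((\<lambda>q. S q j) \<longlongrightarrow> 1 / fact j) ?F" if j: "j \<le> m" for j
  proof (rule tendsto_sandwich)
    have "(\<lambda>q. real j / (real q - 1)) \<longlonglongrightarrow> 0"
      by real_asymp
    then have "(?l j \<longlongrightarrow> 1 / fact j * (1 - 0)) at_top"
      by (intro tendsto_mult tendsto_diff tendsto_choose_over_power
          tendsto_prod_one_minus_power_quotient j)
    then show "(?l j \<longlongrightarrow> 1 / fact j) ?F"
      \<comment> \<open>The bounds converge along all naturals, hence along the prime
        powers.\<close>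
      by (simp add: tendsto_mono[OF inf_le1])
    show "(?u j \<longlongrightarrow> 1 / fact j) ?F"
      by (rule tendsto_mono[OF inf_le1 tendsto_choose_over_power])
  qed (use ev bounds j in \<open>auto elim!: eventually_mono\<close>)
  then have "((\<lambda>q. \<Sum>j\<le>m. (-1) ^ j * S q j) \<longlongrightarrow> (\<Sum>j\<le>m. (-1) ^ j * (1 / fact j))) ?F"
    by (intro tendsto_sum tendsto_mult tendsto_const) auto
  moreover have "\<forall>\<^sub>F q in ?F. (\<Sum>j\<le>m. (-1) ^ j * S q j) = ?p q"
    using ev by eventually_elim (simp add: S)
  ultimately show ?thesis
    using Lim_transform_eventually by force
qed

theorem corollary7p5:
  fixes m :: nat
  assumes "m \<ge> 2"
  shows "(\<forall>(q :: nat) (K :: 'a ring). primepow q \<and> field K \<and> order K = q \<longrightarrow>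
            mrd_proportion K m =
              real (spectrum_free_count K m) / real q ^ (m\<^sup>2) *
              ((\<Prod>i = 0..m - 1. real q ^ (2 * m) - real q ^ (i + m)) /
               (\<Prod>i = 0..m - 1. real q ^ (2 * m) - real q ^ i)))
       \<and> (\<forall>F :: nat \<Rightarrow> 'a ring. (\<forall>q. primepow q \<longrightarrow> field (F q) \<and> order (F q) = q) \<longrightarrow>
            ((\<lambda>q. mrd_proportion (F q) m) \<longlongrightarrow> (\<Sum>j = 0..m. (- 1) ^ j / fact j))
              (inf at_top (principal {q. primepow q})))"
proof -
  let ?r = "\<lambda>q. (\<Prod>i<m. real q ^ (2 * m) - real q ^ (i + m)) / (\<Prod>i<m. real q ^ (2 * m) - real q ^ i)"
  \<comment> \<open>Positivity of \<open>m\<close> matters: truncated subtraction would leave the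
    index 0 at \<open>m = 0\<close>.\<close>
  have m: "{0..m - 1} = {..<m}"
    using assms by auto
  have formula: "mrd_proportion K m = real (spectrum_free_count K m) / real q ^ (m\<^sup>2) * ?r q"
    if q: "primepow q" "field K" "order K = q" for q and K :: "'a ring"
  proof -
    interpret finite_field K
      using that by (rule finite_field_of_order(1))
    show ?thesis
      using mrd_proportion_eq[of m] finite_field_of_order(2)[OF that] by simp
  qed
  have limit: "((\<lambda>q. mrd_proportion (F q) m) \<longlongrightarrow> (\<Sum>j\<le>m. (- 1) ^ j / fact j))
      (inf at_top (principal {q. primepow q}))" (is "(_ \<longlongrightarrow> ?D) ?F")
    if F: "\<forall>q. primepow q \<longrightarrow> field (F q) \<and> order (F q) = q" for F :: "nat \<Rightarrow> 'a ring"
  proof -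
    have "((\<lambda>q. real (spectrum_free_count (F q) m) / real q ^ (m\<^sup>2) * ?r q) \<longlongrightarrow> ?D * 1) ?F"
      using F by (intro tendsto_mult tendsto_spectrum_free_proportion
          tendsto_mono[OF inf_le1 tendsto_subspace_ratio]) auto
    moreover have "\<forall>\<^sub>F q in ?F. real (spectrum_free_count (F q) m) / real q ^ (m\<^sup>2) * ?r q = mrd_proportion (F q) m"
      using F by (auto simp: eventually_inf_principal formula intro!: always_eventually)
    ultimately show ?thesis
      using Lim_transform_eventually by force
  qed
  show ?thesis
    unfolding m unfolding atLeast0AtMost by (intro conjI allI impI formula limit) simp_all
qed

end
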